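(* Let $\mathbb{F}=\mathbb{C}$ or $\mathbb{F}=\mathbb{R}$, and let $\mathcal{L}:\mathbb{F}^{q\times q}\to\mathbb{F}^{n\times n}$ be a $*$-linear map with matricization $L\in\mathbb{F}^{n^2\times q^2}$. If there exists a matrix $C\in\mathbb{F}^{n\times n}$ such that $L\in\overline{\{C\}_{\mathbb{F}}''}\otimes\{C\}_{\mathbb{F}}''$ (so that necessarily $q=n$), then $\mathcal{L}$ is positive if and only if $\mathcal{L}$ is completely positive.
   Context: For $\mathbb{F}=\mathbb{R}$, read $X^*$ as the transpose, $\overline{X}=X$, and "Hermitian" as "symmetric"; positive semidefinite matrices have entries in $\mathbb{F}$. A linear map $\mathcal{L}:\mathbb{F}^{q\times q}\to\mathbb{F}^{n\times n}$ is $*$-linear if $\mathcal{L}(V^* )=\mathcal{L}(V)^*$ for all $V$. It is positive if it maps positive semidefinite matrices to positive semidefinite matrices, and completely positive if for every $k\ge1$ the map $[V_{ij}]_{i,j=1}^k\mapsto[\mathcal{L}(V_{ij})]_{i,j=1}^k$ from $\mathbb{F}^{kq\times kq}$ to $\mathbb{F}^{kn\times kn}$ is positive. The matricization $L\in\mathbb{F}^{n^2\times q^2}$ of $\mathcal{L}$ is the matrix determined by $L\,\mathrm{vec}(V)=\mathrm{vec}(\mathcal{L}(V))$ for all $V\in\mathbb{F}^{q\times q}$, where $\mathrm{vec}$ stacks the columns of a matrix. The bicommutant $\{C\}_{\mathbb{F}}''$ is the set of matrices in $\mathbb{F}^{n\times n}$ commuting with every matrix in $\mathbb{F}^{n\times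 n}$ that commutes with $C$; equivalently $\{C\}_{\mathbb{F}}''=\{p(C):p\in\mathbb{F}[x]\}$. For a set $\mathcal{V}$ of matrices, $\overline{\mathcal{V}}$ is the set of entrywise complex conjugates of its elements. For subspaces $\mathcal{V}_1,\mathcal{V}_2$ of matrices, $\mathcal{V}_1\otimes\mathcal{V}_2$ is the $\mathbb{F}$-linear span of all Kronecker products $X\otimes Y=[x_{ij}Y]$ with $X=[x_{ij}]\in\mathcal{V}_1$, $Y\in\mathcal{V}_2$. *)

theory Defs
  imports "Jordan_Normal_Form.Schur_Decomposition" "Jordan_Normal_Form.VS_Connect"
begin

text \<open>
  The definitions are over a type \<open>'a\<close> with a conjugation and are used only for \<open>'a = complex\<close>
  and \<open>'a = real\<close>. On \<open>real\<close> the library's \<open>conjugate\<close> is the identity, so that \<open>mat_adjoint\<close>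
  is the transpose. On \<open>complex\<close> the relation \<open>0 \<le> z\<close> means that \<open>z\<close> is real and nonnegative.
\<close>

definition psd_mat :: "nat \<Rightarrow> 'a :: conjugatable_ordered_field mat \<Rightarrow> bool" where
  "psd_mat n A \<longleftrightarrow> A \<in> carrier_mat n n \<and> mat_adjoint A = A
     \<and> (\<forall>x \<in> carrier_vec n. 0 \<le> (A *\<^sub>v x) \<bullet>c x)"

definition star_linear :: "nat \<Rightarrow> nat \<Rightarrow> ('a :: conjugatable_field mat \<Rightarrow> 'a mat) \<Rightarrow> bool" where
  "star_linear q n f \<longleftrightarrow>
     linear_map class_ring (module_mat TYPE('a) q q) (module_mat TYPE('a) n n) f
     \<and> (\<forall>V \<in> carrier_mat q q. f (mat_adjoint V) = mat_adjoint (f V))"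

definition positive_map ::
    "nat \<Rightarrow> nat \<Rightarrow> ('a :: conjugatable_ordered_field mat \<Rightarrow> 'a mat) \<Rightarrow> bool" where
  "positive_map q n f \<longleftrightarrow> (\<forall>V. psd_mat q V \<longrightarrow> psd_mat n (f V))"

definition mat_block :: "nat \<Rightarrow> 'a mat \<Rightarrow> nat \<Rightarrow> nat \<Rightarrow> 'a mat" where
  "mat_block q V a b = mat q q (\<lambda>(i, j). V $$ (a * q + i, b * q + j))"

text \<open>The map sending the block matrix \<open>[V\<^sub>a\<^sub>b]\<close> to \<open>[f V\<^sub>a\<^sub>b]\<close>, with blocks indexed by \<open>a, b < k\<close>.\<close>

definition block_map ::
    "nat \<Rightarrow> nat \<Rightarrow> nat \<Rightarrow> ('a mat \<Rightarrow> 'a mat) \<Rightarrow> 'a mat \<Rightarrow> 'a mat" where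
  "block_map k q n f V =
     mat (k * n) (k * n) (\<lambda>(i, j). f (mat_block q V (i div n) (j div n)) $$ (i mod n, j mod n))"

definition completely_positive ::
    "nat \<Rightarrow> nat \<Rightarrow> ('a :: conjugatable_ordered_field mat \<Rightarrow> 'a mat) \<Rightarrow> bool" where
  "completely_positive q n f \<longleftrightarrow>
     (\<forall>k \<ge> 1. positive_map (k * q) (k * n) (block_map k q n f))"

text \<open>Column stacking: entry \<open>(i, j)\<close> is placed at position \<open>j * dim_row A + i\<close>.\<close>

definition vec_cols :: "'a mat \<Rightarrow> 'a vec" where
  "vec_cols A = vec (dim_row A * dim_col A) (\<lambda>k. A $$ (k mod dim_row A, k div dim_row A))"

definition is_matricization ::
    "nat \<Rightarrow> nat \<Rightarrow> ('a :: semiring_0 mat \<Rightarrow> 'a mat) \<Rightarrow> 'a mat \<Rightarrow> bool" where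
  "is_matricization q n f M \<longleftrightarrow> M \<in> carrier_mat (n^2) (q^2)
     \<and> (\<forall>V \<in> carrier_mat q q. M *\<^sub>v vec_cols V = vec_cols (f V))"

definition commutant :: "nat \<Rightarrow> 'a :: semiring_0 mat set \<Rightarrow> 'a mat set" where
  "commutant n S = {X \<in> carrier_mat n n. \<forall>Y \<in> S. X * Y = Y * X}"

definition bicommutant :: "nat \<Rightarrow> 'a :: semiring_0 mat \<Rightarrow> 'a mat set" where
  "bicommutant n C = commutant n (commutant n {C})"

definition kronecker :: "'a :: times mat \<Rightarrow> 'a mat \<Rightarrow> 'a mat" where
  "kronecker X Y = mat (dim_row X * dim_row Y) (dim_col X * dim_col Y)
     (\<lambda>(i, j). X $$ (i div dim_row Y, j div dim_col Y) * Y $$ (i mod dim_row Y, j mod dim_col Y))"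

text \<open>The tensor product of two subspaces of the \<open>n\<close> by \<open>n\<close> matrices.\<close>

definition tensor_space :: "nat \<Rightarrow> 'a :: field mat set \<Rightarrow> 'a mat set \<Rightarrow> 'a mat set" where
  "tensor_space n \<V> \<W> = LinearCombinations.module.span class_ring (module_mat TYPE('a) (n^2) (n^2))
     {kronecker X Y | X Y. X \<in> \<V> \<and> Y \<in> \<W>}"

end

theory Submission
  imports Defs
    "HOL-Computational_Algebra.Field_as_Ring"
    "HOL-Computational_Algebra.Polynomial_Factorial"
begin

text \<open>
  Since \<open>(conj Z \<otimes> X) vec V = vec (X V Z\<^sup>*)\<close> and \<open>L\<close> commutes with \<open>conj Z \<otimes> X\<close> whenever \<open>X\<close> and \<open>Z\<close>
  commute with \<open>C\<close>, the map satisfies \<open>f (X V Z\<^sup>*) = X (f V) Z\<^sup>*\<close> for all \<open>X, Z\<close> in the commutant of \<open>C\<close>.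
  The commutant has a cyclic vector \<open>v\<close>: every \<open>w\<close> is \<open>X v\<close> for some \<open>X\<close> commuting with \<open>C\<close>.
  Hence the blocks of \<open>u u\<^sup>*\<close> are \<open>X\<^sub>a v v\<^sup>* X\<^sub>b\<^sup>*\<close>, and the block map sends \<open>u u\<^sup>*\<close> to
  \<open>[X\<^sub>a f(v v\<^sup>*) X\<^sub>b\<^sup>*] = Y f(v v\<^sup>*) Y\<^sup>*\<close>, where \<open>Y\<close> stacks the \<open>X\<^sub>a\<close>; this is positive semidefinite as soon
  as \<open>f(v v\<^sup>*)\<close> is. Positive semidefinite matrices are sums of nonnegative multiples of such \<open>u u\<^sup>*\<close>.

  A cyclic vector is any \<open>v\<close> whose annihilating polynomial is the minimal polynomial of \<open>C\<close>. This works
  over any field, so both cases of the theorem are instances of one statement.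
\<close>

section \<open>Positive semidefinite matrices\<close>

lemma mat_adjoint_carrier [simp]:
  "A \<in> carrier_mat n m \<Longrightarrow> mat_adjoint A \<in> carrier_mat m n"
  by (auto simp: mat_adjoint_def)

lemma dim_mat_adjoint [simp]:
  "dim_row (mat_adjoint A) = dim_col A" "dim_col (mat_adjoint A) = dim_row A"
  by (auto simp: mat_adjoint_def)

lemma index_mat_adjoint [simp]:
  "i < dim_col A \<Longrightarrow> j < dim_row A \<Longrightarrow> mat_adjoint A $$ (i, j) = conjugate (A $$ (j, i))"
  by (simp add: mat_adjoint_def mat_of_rows_index)

lemma mult_mat_vec_cscalar_prod:
  fixes A :: "'a::conjugatable_field mat"
  assumes A: "A \<in> carrier_mat n m" and x: "x \<in> carrier_vec m" and y: "y \<in> carrier_vec n"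
  shows "(A *\<^sub>v x) \<bullet>c y = x \<bullet>c (mat_adjoint A *\<^sub>v y)"
proof -
  have "(A *\<^sub>v x) \<bullet>c y = (\<Sum>i<n. \<Sum>j<m. A $$ (i, j) * x $ j * conjugate (y $ i))"
    using assms by (simp add: scalar_prod_def atLeast0LessThan sum_distrib_right)
  also have "\<dots> = (\<Sum>j<m. \<Sum>i<n. A $$ (i, j) * x $ j * conjugate (y $ i))"
    by (rule sum.swap)
  also have "\<dots> = x \<bullet>c (mat_adjoint A *\<^sub>v y)"
    using assms by (simp add: scalar_prod_def atLeast0LessThan sum_distrib_left sum_conjugate
        conjugate_dist_mul mult_ac)
  finally show ?thesis .
qed



lemma mat_adjoint_mult:
  fixes A B :: "'a::conjugatable_field mat"
  assumes "A \<in> carrier_mat m n" "B \<in> carrier_mat n p"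
  shows "mat_adjoint (A * B) = mat_adjoint B * mat_adjoint A"
  using assms by (intro eq_matI) (auto simp: scalar_prod_def sum_conjugate conjugate_dist_mul mult.commute)

lemma mat_adjoint_adjoint [simp]: "mat_adjoint (mat_adjoint A) = A"
  by (intro eq_matI) auto

text \<open>Multiplicativity makes \<open>conjugate 1\<close> a nonzero idempotent, and a field has
  only one.\<close>

lemma conjugate_one [simp]: "conjugate (1 :: 'a::conjugatable_field) = 1"
proof -
  have "conjugate (1::'a) * conjugate 1 = conjugate 1 * 1"
    by (simp flip: conjugate_dist_mul)
  then show ?thesis by (metis conjugate_zero_iff mult_cancel_left zero_neq_one)
qed

lemma conjugate_inverse: "conjugate (inverse (a :: 'a::conjugatable_field)) = inverse (conjugate a)"
proof (cases "a = 0")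
  case False
  then have "conjugate a * conjugate (inverse a) = 1" by (simp flip: conjugate_dist_mul)
  then show ?thesis by (metis inverse_unique)
qed simp

lemma psd_matD:
  assumes "psd_mat n A"
  shows "A \<in> carrier_mat n n" "mat_adjoint A = A" "\<And>x. x \<in> carrier_vec n \<Longrightarrow> 0 \<le> (A *\<^sub>v x) \<bullet>c x"
  using assms by (auto simp: psd_mat_def)

lemma hermitian_index:
  assumes "mat_adjoint A = A" "A \<in> carrier_mat n n" "i < n" "j < n"
  shows "conjugate (A $$ (i, j)) = A $$ (j, i)"
  using assms index_mat_adjoint[of j A i] by auto

lemma psd_mat_zero: "psd_mat n (0\<^sub>m n n)"
proof -
  have "0\<^sub>m n n *\<^sub>v x = 0\<^sub>v n" if "x \<in> carrier_vec n" for x :: "'a vec"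
    using that by (intro eq_vecI) auto
  then show ?thesis by (auto simp: psd_mat_def intro!: eq_matI)
qed

lemma psd_mat_add:
  assumes A: "psd_mat n A" and B: "psd_mat n B"
  shows "psd_mat n (A + B)"
proof -
  note a = psd_matD[OF A] and b = psd_matD[OF B]
  have "mat_adjoint (A + B) = A + B"
    using hermitian_index[OF a(2,1)] hermitian_index[OF b(2,1)] a(1) b(1)
    by (intro eq_matI) (auto simp: conjugate_dist_add)
  moreover have "((A + B) *\<^sub>v x) \<bullet>c x = (A *\<^sub>v x) \<bullet>c x + (B *\<^sub>v x) \<bullet>c x" if "x \<in> carrier_vec n" for x
    using a(1) b(1) that by (simp add: add_mult_distrib_mat_vec[of A n n] add_scalar_prod_distrib[of _ n])
  ultimately show ?thesis using a b by (auto simp: psd_mat_def)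
qed

lemma psd_mat_smult:
  fixes c :: "'a::{conjugatable_ordered_field, ordered_comm_ring}"
  assumes A: "psd_mat n A" and c: "0 \<le> c" "conjugate c = c"
  shows "psd_mat n (c \<cdot>\<^sub>m A)"
proof -
  note a = psd_matD[OF A]
  have "mat_adjoint (c \<cdot>\<^sub>m A) = c \<cdot>\<^sub>m A"
    using hermitian_index[OF a(2,1)] a(1) c by (intro eq_matI) (auto simp: conjugate_dist_mul)
  moreover have "((c \<cdot>\<^sub>m A) *\<^sub>v x) \<bullet>c x = c * ((A *\<^sub>v x) \<bullet>c x)" if x: "x \<in> carrier_vec n" for x
  proof -
    have "(c \<cdot>\<^sub>m A) *\<^sub>v x = c \<cdot>\<^sub>v (A *\<^sub>v x)" using a(1) x by (intro eq_vecI) auto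
    then show ?thesis using a(1) x by simp
  qed
  ultimately show ?thesis using a c by (auto simp: psd_mat_def)
qed

text \<open>Moving \<open>Y\<close> to the other side of the scalar product turns the form at
  \<open>x\<close> into the form of \<open>A\<close> at \<open>mat_adjoint Y *\<^sub>v x\<close>.
  Rectangular \<open>Y\<close> matters: the lemma is applied to a stack of square blocks.\<close>

lemma psd_mat_congruence:
  assumes A: "psd_mat n A" and Y: "Y \<in> carrier_mat m n"
  shows "psd_mat m (Y * A * mat_adjoint Y)"
proof -
  note a = psd_matD[OF A]
  have Yc: "mat_adjoint Y \<in> carrier_mat n m" using Y by simp
  have YA: "Y * A \<in> carrier_mat m n" using Y a(1) by simp
  have "mat_adjoint (Y * A * mat_adjoint Y) = Y * (A * mat_adjoint Y)"
    using mat_adjoint_mult[OF YA Yc] mat_adjoint_mult[OF Y a(1)] a(2) by simp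
  also have "\<dots> = Y * A * mat_adjoint Y" by (rule assoc_mult_mat[OF Y a(1) Yc, symmetric])
  finally have "mat_adjoint (Y * A * mat_adjoint Y) = Y * A * mat_adjoint Y" .
  moreover have "0 \<le> ((Y * A * mat_adjoint Y) *\<^sub>v x) \<bullet>c x" if x: "x \<in> carrier_vec m" for x
  proof -
    have y: "mat_adjoint Y *\<^sub>v x \<in> carrier_vec n" using Yc x by simp
    have "(Y * A * mat_adjoint Y) *\<^sub>v x = Y *\<^sub>v (A *\<^sub>v (mat_adjoint Y *\<^sub>v x))"
      by (simp only: assoc_mult_mat_vec[OF YA Yc x] assoc_mult_mat_vec[OF Y a(1) y])
    then have "((Y * A * mat_adjoint Y) *\<^sub>v x) \<bullet>c x
        = (A *\<^sub>v (mat_adjoint Y *\<^sub>v x)) \<bullet>c (mat_adjoint Y *\<^sub>v x)"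
      using mult_mat_vec_cscalar_prod[OF Y _ x] a(1) y by simp
    then show ?thesis using a(3)[OF y] by simp
  qed
  ultimately show ?thesis using YA Yc by (auto simp: psd_mat_def)
qed

section \<open>Rank-one matrices and Schur complements\<close>

definition outer :: "nat \<Rightarrow> 'a::conjugatable_field vec \<Rightarrow> 'a mat" where
  "outer n u = mat n n (\<lambda>(i, j). u $ i * conjugate (u $ j))"

lemma outer_carrier [simp]: "outer n u \<in> carrier_mat n n"
  by (simp add: outer_def)

lemma outer_mult_vec:
  assumes "u \<in> carrier_vec n" "x \<in> carrier_vec n"
  shows "outer n u *\<^sub>v x = (x \<bullet>c u) \<cdot>\<^sub>v u"
  using assms by (intro eq_vecI) (auto simp: outer_def scalar_prod_def sum_distrib_left mult_ac
      intro!: sum.cong)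

text \<open>By \<open>outer_mult_vec\<close> the form at \<open>x\<close> is
  \<open>x \<bullet>c u\<close> times its conjugate.\<close>

lemma psd_mat_outer:
  fixes u :: "'a::conjugatable_ordered_field vec"
  assumes u: "u \<in> carrier_vec n"
  shows "psd_mat n (outer n u)"
proof -
  have "mat_adjoint (outer n u) = outer n u"
    by (intro eq_matI) (auto simp: outer_def conjugate_dist_mul mult.commute)
  moreover have "(outer n u *\<^sub>v x) \<bullet>c x = (x \<bullet>c u) * conjugate (x \<bullet>c u)" if x: "x \<in> carrier_vec n" for x
  proof -
    have "conjugate (x \<bullet>c u) = u \<bullet>c x"
      using conjugate_conjugate_sprod[of u n x] x u
      by (metis carrier_vec_conjugate conjugate_id conjugate_sprod_vec comm_scalar_prod)
    then show ?thesis using u x by (simp add: outer_mult_vec)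
  qed
  ultimately show ?thesis by (simp add: psd_mat_def conjugate_square_positive)
qed

text \<open>Since \<open>A\<close> is Hermitian, both cross terms are governed by the single entry
  \<open>(A *\<^sub>v x) $ i\<close>. A suitable \<open>c\<close> yields a contradiction when
  \<open>A $$ (i, i) = 0\<close> and completes the square otherwise.\<close>

lemma quadratic_form_add_unit_vec:
  fixes A :: "'a::conjugatable_field mat"
  assumes A: "A \<in> carrier_mat n n" and herm: "mat_adjoint A = A" and x: "x \<in> carrier_vec n" and i: "i < n"
  shows "(A *\<^sub>v (x + c \<cdot>\<^sub>v unit_vec n i)) \<bullet>c (x + c \<cdot>\<^sub>v unit_vec n i)
    = (A *\<^sub>v x) \<bullet>c x + conjugate c * (A *\<^sub>v x) $ i + c * conjugate ((A *\<^sub>v x) $ i)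
      + c * conjugate c * A $$ (i, i)"
proof -
  let ?e = "unit_vec n i :: 'a vec"
  have e: "conjugate ?e = ?e" by (rule eq_vecI) (auto simp: unit_vec_def)
  have Ax: "A *\<^sub>v x \<in> carrier_vec n" and Ae: "A *\<^sub>v ?e \<in> carrier_vec n" using A x by auto
  have "(A *\<^sub>v ?e) \<bullet>c x = ?e \<bullet>c (A *\<^sub>v x)"
    using mult_mat_vec_cscalar_prod[OF A _ x, of ?e] herm by simp
  also have "\<dots> = conjugate ((A *\<^sub>v x) $ i)"
    using Ax A i by (simp add: scalar_prod_left_unit[of _ n])
  finally have Aex: "(A *\<^sub>v ?e) \<bullet>c x = conjugate ((A *\<^sub>v x) $ i)" .
  have Axe: "(A *\<^sub>v x) \<bullet> ?e = (A *\<^sub>v x) $ i" using Ax i by (simp add: scalar_prod_right_unit[of _ n])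
  have Aee: "(A *\<^sub>v ?e) \<bullet> ?e = A $$ (i, i)"
    using Ae A i by (simp add: scalar_prod_right_unit[of _ n])
  have "A *\<^sub>v (x + c \<cdot>\<^sub>v ?e) = A *\<^sub>v x + c \<cdot>\<^sub>v (A *\<^sub>v ?e)"
    using A x by (simp add: mult_add_distrib_mat_vec[of _ n n] mult_mat_vec[of _ n n])
  moreover have "conjugate (x + c \<cdot>\<^sub>v ?e) = conjugate x + conjugate c \<cdot>\<^sub>v ?e"
    using x by (simp add: conjugate_add_vec[of _ n] conjugate_smult_vec e)
  ultimately show ?thesis
    using Ax Ae x Aex Axe Aee
    by (simp add: add_scalar_prod_distrib[of _ n] scalar_prod_add_distrib[of _ n] algebra_simps)
qed

text \<open>With a zero at \<open>(i, i)\<close> the quadratic term in \<open>c\<close> disappears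
  from the form at \<open>unit_vec n j + c \<cdot>\<^sub>v unit_vec n i\<close>. What is left is
  affine in \<open>c\<close> over the reals and would take negative values if its linear part were
  nonzero.\<close>

lemma psd_mat_zero_diag:
  fixes A :: "'a::{conjugatable_ordered_field, ordered_comm_ring} mat"
  assumes A: "psd_mat n A" and i: "i < n" and j: "j < n" and z: "A $$ (i, i) = 0"
  shows "A $$ (i, j) = 0"
proof (rule ccontr)
  assume nz: "A $$ (i, j) \<noteq> 0"
  note a = psd_matD[OF A]
  let ?b = "A $$ (i, j)" and ?d = "A $$ (j, j)"
  have d: "conjugate ?d = ?d" by (rule hermitian_index[OF a(2,1) j j])
  have ej: "(A *\<^sub>v unit_vec n j) $ i = ?b" "(A *\<^sub>v unit_vec n j) \<bullet>c unit_vec n j = ?d"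
  proof -
    have "A *\<^sub>v unit_vec n j \<in> carrier_vec n" "conjugate (unit_vec n j) = (unit_vec n j :: 'a vec)"
      using a(1) by (auto simp: unit_vec_def)
    then show "(A *\<^sub>v unit_vec n j) $ i = ?b" "(A *\<^sub>v unit_vec n j) \<bullet>c unit_vec n j = ?d"
      using a(1) i j by (simp_all add: scalar_prod_right_unit[of _ n])
  qed
  \<comment> \<open>\<open>c\<close> is chosen so that the form takes the value \<open>- (?d + 2)\<close> at \<open>e\<^sub>j + c e\<^sub>i\<close>\<close>
  define s where "s = (?d + 1) * inverse (?b * conjugate ?b)"
  define c where "c = - s * ?b"
  have s: "conjugate s = s"
    by (simp add: s_def conjugate_dist_mul conjugate_dist_add conjugate_inverse d mult.commute)
  have "inverse (?b * conjugate ?b) * (?b * conjugate ?b) = 1"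
    using nz by (intro left_inverse) simp
  then have sb: "s * (?b * conjugate ?b) = ?d + 1" by (simp only: s_def mult.assoc mult_1_right)
  have "0 \<le> (A *\<^sub>v (unit_vec n j + c \<cdot>\<^sub>v unit_vec n i)) \<bullet>c (unit_vec n j + c \<cdot>\<^sub>v unit_vec n i)"
    by (intro a(3)) simp
  also have "\<dots> = ?d + conjugate c * ?b + c * conjugate ?b"
    by (simp add: quadratic_form_add_unit_vec[OF a(1,2) _ i] ej z)
  also have "\<dots> = ?d - s * (?b * conjugate ?b) - s * (?b * conjugate ?b)"
    by (simp add: c_def conjugate_neg conjugate_dist_mul s mult_ac)
  also have "\<dots> = - (?d + 1 + 1)" by (simp add: sb)
  finally have "?d + 1 + 1 \<le> 0" by (simp only: neg_0_le_iff_le)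
  moreover have "0 \<le> ?d" using a(3)[of "unit_vec n j"] ej(2) by simp
  moreover have "(0::'a) < 1" using conjugate_square_greater_0[of "1::'a"] by simp
  ultimately show False
    by (metis add_nonneg_pos leD less_imp_le)
qed

text \<open>Completing the square: with \<open>t = (A *\<^sub>v x) $ i\<close>, the form of the
  Schur complement at \<open>x\<close> is the form of \<open>A\<close> at
  \<open>x + (- c * t) \<cdot>\<^sub>v unit_vec n i\<close>, so nonnegativity is inherited.\<close>

lemma psd_mat_schur_step:
  fixes A :: "'a::{conjugatable_ordered_field, ordered_comm_ring} mat"
  assumes A: "psd_mat n A" and i: "i < n" and nz: "A $$ (i, i) \<noteq> 0"
  defines "c \<equiv> inverse (A $$ (i, i))"
  shows "psd_mat n (A - c \<cdot>\<^sub>m outer n (col A i))" and "0 \<le> c" and "conjugate c = c"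
proof -
  note a = psd_matD[OF A]
  let ?d = "A $$ (i, i)" and ?u = "col A i"
  let ?B = "A - c \<cdot>\<^sub>m outer n ?u"
  have d: "conjugate ?d = ?d" by (rule hermitian_index[OF a(2,1) i i])
  have u: "?u \<in> carrier_vec n" using a(1) by auto
  have Ae: "A *\<^sub>v unit_vec n i = ?u"
    using a(1) i by (intro eq_vecI) (auto simp: scalar_prod_right_unit[of _ n])
  show cc: "conjugate c = c" by (simp add: c_def conjugate_inverse d)
  have "conjugate (unit_vec n i) = (unit_vec n i :: 'a vec)" by (auto simp: unit_vec_def)
  then have "0 \<le> ?d" using a(3)[of "unit_vec n i"] Ae u i a(1) by (simp add: scalar_prod_right_unit[of _ n])
  \<comment> \<open>The inverse \<open>c\<close> is nonnegative because it equals \<open>?d\<close>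
    times the conjugate square of \<open>c\<close>.\<close>
  then have "0 \<le> ?d * (c * conjugate c)" by (intro mult_nonneg_nonneg conjugate_square_positive)
  moreover have "?d * (c * conjugate c) = c"
    unfolding cc using nz by (simp add: c_def flip: mult.assoc)
  ultimately show "0 \<le> c" by simp
  have "mat_adjoint ?B = ?B"
    using hermitian_index[OF a(2,1)] a(1) cc
    by (intro eq_matI) (auto simp: outer_def conjugate_dist_mul conjugate_dist_add conjugate_neg
        diff_conv_add_uminus mult_ac simp del: add_uminus_conv_diff)
  moreover have "0 \<le> (?B *\<^sub>v x) \<bullet>c x" if x: "x \<in> carrier_vec n" for x
  proof -
    let ?t = "(A *\<^sub>v x) $ i"
    have Ax: "A *\<^sub>v x \<in> carrier_vec n" using a(1) x by simp
    have xu: "x \<bullet>c ?u = ?t"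
      using mult_mat_vec_cscalar_prod[OF a(1) x, of "unit_vec n i"] a(2) Ae Ax i
        \<open>conjugate (unit_vec n i) = (unit_vec n i :: 'a vec)\<close>
      by (simp add: scalar_prod_right_unit[of _ n])
    have ux: "?u \<bullet>c x = conjugate ?t"
      using mult_mat_vec_cscalar_prod[OF a(1) _ x, of "unit_vec n i"] a Ae Ax i
      by (simp add: scalar_prod_left_unit[of _ n])
    have "?B *\<^sub>v x = A *\<^sub>v x - (c * ?t) \<cdot>\<^sub>v ?u"
    proof -
      have "?B *\<^sub>v x = A *\<^sub>v x - (c \<cdot>\<^sub>m outer n ?u) *\<^sub>v x"
        using a(1) x by (intro minus_mult_distrib_mat_vec) auto
      also have "(c \<cdot>\<^sub>m outer n ?u) *\<^sub>v x = c \<cdot>\<^sub>v (outer n ?u *\<^sub>v x)"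
        using x by (intro eq_vecI) (auto simp: outer_def)
      finally show ?thesis by (simp add: outer_mult_vec[OF u x] xu smult_smult_assoc)
    qed
    then have "(?B *\<^sub>v x) \<bullet>c x = (A *\<^sub>v x) \<bullet>c x - c * ?t * conjugate ?t"
      using Ax u x ux by (simp add: minus_scalar_prod_distrib[of _ n])
    \<comment> \<open>With this shift the two linear terms contribute
      \<open>- 2 * c * ?t * conjugate ?t\<close> and the quadratic term gives half of that back,
      because \<open>c * ?d = 1\<close>.\<close>
    also have "\<dots> = (A *\<^sub>v (x + (- c * ?t) \<cdot>\<^sub>v unit_vec n i)) \<bullet>c (x + (- c * ?t) \<cdot>\<^sub>v unit_vec n i)"
    proof -
      have "c * ?d = 1" using nz by (simp add: c_def)
      then have "(- c * ?t) * conjugate (- c * ?t) * ?d = c * (?t * conjugate ?t)"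
        by (simp add: conjugate_neg conjugate_dist_mul cc)
      then show ?thesis unfolding quadratic_form_add_unit_vec[OF a(1,2) x i]
        by (simp add: conjugate_neg conjugate_dist_mul cc mult_ac)
    qed
    also have "0 \<le> \<dots>" using x by (intro a(3)) simp
    finally show ?thesis .
  qed
  ultimately show "psd_mat n ?B" by (simp add: psd_mat_def minus_carrier_mat)
qed

text \<open>Each Schur step clears the diagonal entry it pivots on and keeps zero diagonal entries
  zero, so the number of nonzero ones drops; when none is left, \<open>psd_mat_zero_diag\<close>
  makes the matrix zero. The scalar \<open>c\<close> stays apart from \<open>u\<close>, so no square
  root has to exist in the field.\<close>

lemma psd_mat_induct [consumes 1, case_names zero add]:
  fixes A :: "'a::{conjugatable_ordered_field, ordered_comm_ring} mat"
  assumes "psd_mat n A" and zero: "P (0\<^sub>m n n)"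
    and add: "\<And>B c u. psd_mat n B \<Longrightarrow> P B \<Longrightarrow> 0 \<le> c \<Longrightarrow> conjugate c = c \<Longrightarrow> u \<in> carrier_vec n
      \<Longrightarrow> P (B + c \<cdot>\<^sub>m outer n u)"
  shows "P A"
  using assms(1)
proof (induction "card {i. i < n \<and> A $$ (i, i) \<noteq> 0}" arbitrary: A rule: less_induct)
  case less
  note a = psd_matD[OF less.prems]
  show ?case
  proof (cases "\<exists>i<n. A $$ (i, i) \<noteq> 0")
    case False
    then have "A = 0\<^sub>m n n"
      using psd_mat_zero_diag[OF less.prems] a(1) by (intro eq_matI) auto
    then show ?thesis using zero by simp
  next
    case True
    then obtain i where i: "i < n" and nz: "A $$ (i, i) \<noteq> 0" by blast
    define c where "c = inverse (A $$ (i, i))"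
    let ?u = "col A i"
    let ?B = "A - c \<cdot>\<^sub>m outer n ?u"
    note B = psd_mat_schur_step[OF less.prems i nz, folded c_def]
    \<comment> \<open>Row \<open>j\<close> of \<open>A\<close> vanishes by
      \<open>psd_mat_zero_diag\<close>, hence \<open>?u $ j = 0\<close> and the subtracted matrix is
      zero at \<open>(j, j)\<close>.\<close>
    have "?B $$ (j, j) = 0" if "j < n" "A $$ (j, j) = 0" for j
      using psd_mat_zero_diag[OF less.prems that(1) i that(2)] that a(1) i by (simp add: outer_def)
    moreover have "?B $$ (i, i) = 0"
      using nz i a(1) hermitian_index[OF a(2,1) i i] by (simp add: outer_def c_def)
    ultimately have "{j. j < n \<and> ?B $$ (j, j) \<noteq> 0} \<subset> {j. j < n \<and> A $$ (j, j) \<noteq> 0}"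
      using i nz by blast
    then have "P ?B" using B(1) by (intro less.hyps psubset_card_mono) auto
    then have "P (?B + c \<cdot>\<^sub>m outer n ?u)" using B a(1) i by (intro add) auto
    moreover have "?B + c \<cdot>\<^sub>m outer n ?u = A" using a(1) by (intro eq_matI) (auto simp: outer_def)
    ultimately show ?thesis by simp
  qed
qed

section \<open>A cyclic vector for the commutant\<close>

lemma coeff_sum_monom_lessThan:
  "coeff (\<Sum>i<m. monom (c i :: 'b::comm_monoid_add) i) j = (if j < m then c j else 0)"
  by (auto simp: coeff_sum if_distrib cong: if_cong)

text \<open>This is p(C) v by Horner's rule on vectors, without matrix powers. It makes the vectors
  a module over the polynomial ring, where divisibility arguments apply.\<close>

definition poly_act :: "'a::field mat \<Rightarrow> 'a poly \<Rightarrow> 'a vec \<Rightarrow> 'a vec" where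
  "poly_act C p v = fold_coeffs (\<lambda>a w. a \<cdot>\<^sub>v v + C *\<^sub>v w) p (0\<^sub>v (dim_vec v))"

context
  fixes C :: "'a::field mat" and n :: nat
  assumes C: "C \<in> carrier_mat n n"
begin

lemma poly_act_0 [simp]: "v \<in> carrier_vec n \<Longrightarrow> poly_act C 0 v = 0\<^sub>v n"
  by (auto simp: poly_act_def)

lemma poly_act_pCons:
  assumes "v \<in> carrier_vec n"
  shows "poly_act C (pCons a p) v = a \<cdot>\<^sub>v v + C *\<^sub>v poly_act C p v"
\<comment> \<open>\<open>fold_coeffs\<close> ignores zero coefficients at the top, so
  \<open>pCons 0 0\<close> triggers no iteration and needs its own case.\<close>
proof (cases "p = 0 \<and> a = 0")
  case True
  then show ?thesis using C assms by (auto intro!: eq_vecI)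
next
  case False
  then show ?thesis by (auto simp: poly_act_def)
qed

lemma poly_act_carrier [simp]:
  assumes "v \<in> carrier_vec n"
  shows "poly_act C p v \<in> carrier_vec n"
  using C assms by (induction p) (auto simp: poly_act_pCons)

lemma poly_act_zero_vec [simp]: "poly_act C p (0\<^sub>v n) = 0\<^sub>v n"
  using C by (induction p) (auto simp: poly_act_pCons)

lemma poly_act_add:
  assumes "v \<in> carrier_vec n"
  shows "poly_act C (p + q) v = poly_act C p v + poly_act C q v"
proof (induction p q rule: poly_induct2)
  case 0
  then show ?case using assms by simp
next
  case (pCons a p b q)
  have "C *\<^sub>v (poly_act C p v + poly_act C q v) = C *\<^sub>v poly_act C p v + C *\<^sub>v poly_act C q v"
    using C assms by (intro mult_add_distrib_mat_vec) auto
  then show ?case using C assms pCons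
    by (auto simp: poly_act_pCons add_smult_distrib_vec intro!: eq_vecI)
qed

lemma poly_act_smult:
  assumes "v \<in> carrier_vec n"
  shows "poly_act C (smult c p) v = c \<cdot>\<^sub>v poly_act C p v"
proof (induction p)
  case 0
  then show ?case using assms by auto
next
  case (pCons a p)
  have "C *\<^sub>v (c \<cdot>\<^sub>v poly_act C p v) = c \<cdot>\<^sub>v (C *\<^sub>v poly_act C p v)"
    using C assms by (intro mult_mat_vec) auto
  then show ?case using C assms pCons
    by (auto simp: poly_act_pCons algebra_simps intro!: eq_vecI)
qed

lemma poly_act_mult:
  assumes "v \<in> carrier_vec n"
  shows "poly_act C (p * q) v = poly_act C p (poly_act C q v)"
proof (induction p)
  case 0
  then show ?case using assms by simp
next
  case (pCons a p)
  have "0 \<cdot>\<^sub>v v + C *\<^sub>v poly_act C (p * q) v = C *\<^sub>v poly_act C (p * q) v"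
    using C assms by (intro eq_vecI) auto
  then show ?case using C assms pCons
    by (simp add: poly_act_add poly_act_smult poly_act_pCons)
qed

lemma poly_act_add_vec:
  assumes "v \<in> carrier_vec n" "w \<in> carrier_vec n"
  shows "poly_act C p (v + w) = poly_act C p v + poly_act C p w"
proof (induction p)
  case 0
  then show ?case using assms by simp
next
  case (pCons a p)
  have "C *\<^sub>v (poly_act C p v + poly_act C p w) = C *\<^sub>v poly_act C p v + C *\<^sub>v poly_act C p w"
    using C assms by (intro mult_add_distrib_mat_vec) auto
  then show ?case using C assms pCons
    by (auto simp: poly_act_pCons algebra_simps intro!: eq_vecI)
qed

lemma poly_act_const:
  assumes "v \<in> carrier_vec n"
  shows "poly_act C [:a:] v = a \<cdot>\<^sub>v v"
proof -
  have "C *\<^sub>v 0\<^sub>v n = 0\<^sub>v n" using C by (intro eq_vecI) auto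
  then show ?thesis using C assms by (simp add: poly_act_pCons)
qed

lemma poly_act_X:
  assumes "v \<in> carrier_vec n"
  shows "poly_act C [:0, 1:] v = C *\<^sub>v v"
proof -
  have "0 \<cdot>\<^sub>v v + C *\<^sub>v v = C *\<^sub>v v" using C assms by (intro eq_vecI) auto
  then show ?thesis using poly_act_pCons[OF assms, of 0 "[:1:]"] poly_act_const[OF assms, of 1] by simp
qed

lemma poly_act_monom_Suc:
  assumes "v \<in> carrier_vec n"
  shows "poly_act C (monom 1 (Suc i)) v = poly_act C (monom 1 i) (C *\<^sub>v v)"
proof -
  have "monom 1 (Suc i) = monom 1 i * [:0, 1:: 'a:]"
    by (simp add: monom_Suc)
  then show ?thesis using assms by (simp only: poly_act_mult poly_act_X)
qed

lemma poly_act_sum_index: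
  assumes "v \<in> carrier_vec n" "r < n"
  shows "poly_act C (\<Sum>i<m. monom (c i) i) v $ r = (\<Sum>i<m. c i * poly_act C (monom 1 i) v $ r)"
proof (induction m)
  case 0
  then show ?case using assms by simp
next
  case (Suc m)
  have car: "dim_vec (poly_act C p v) = n" for p
    using carrier_vecD[OF poly_act_carrier[OF assms(1)]] .
  have "poly_act C (monom (c m) m) v = c m \<cdot>\<^sub>v poly_act C (monom 1 m) v"
    using poly_act_smult[OF assms(1), of "c m" "monom 1 m"] by (simp add: smult_monom)
  then show ?case using assms Suc by (simp add: poly_act_add car)
qed

text \<open>The n + 1 vectors v, C v, ..., C^n v are linearly dependent in dimension n, and the
  coefficients of a dependence are those of the polynomial.\<close>

lemma annihilating_poly_exists:
  assumes v: "v \<in> carrier_vec n"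
  shows "\<exists>p. p \<noteq> 0 \<and> degree p \<le> n \<and> poly_act C p v = 0\<^sub>v n"
proof -
  \<comment> \<open>Column \<open>i\<close> holds C^i v. The zero row at the bottom makes the matrix
    square and puts the last unit vector into the kernel of the transpose, so the determinant
    vanishes.\<close>
  define A where "A = mat (Suc n) (Suc n) (\<lambda>(r, i). if r < n then poly_act C (monom 1 i) v $ r else 0)"
  have A: "A \<in> carrier_mat (Suc n) (Suc n)" by (simp add: A_def)
  have "A\<^sup>T *\<^sub>v unit_vec (Suc n) n = 0\<^sub>v (Suc n)"
    by (rule eq_vecI) (auto simp: A_def)
  then have "det (A\<^sup>T) = 0"
    using A by (subst det_0_iff_vec_prod_zero_field[of _ "Suc n"]) (auto intro!: exI[of _ "unit_vec (Suc n) n"])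
  then have "det A = 0" using det_transpose[OF A] by simp
  then obtain c where c: "c \<in> carrier_vec (Suc n)" "c \<noteq> 0\<^sub>v (Suc n)" "A *\<^sub>v c = 0\<^sub>v (Suc n)"
    using det_0_iff_vec_prod_zero_field[OF A] by blast
  define p where "p = (\<Sum>i<Suc n. monom (c $ i) i)"
  have co: "coeff p j = (if j < Suc n then c $ j else 0)" for j
    unfolding p_def by (rule coeff_sum_monom_lessThan)
  have "p \<noteq> 0"
  proof
    assume "p = 0"
    then have "c $ j = 0" if "j < Suc n" for j using co[of j] that by simp
    then have "c = 0\<^sub>v (Suc n)" using c(1) by (intro eq_vecI) auto
    with c(2) show False by simp
  qed
  moreover have "degree p \<le> n" by (rule degree_le) (simp add: co)
  moreover have "poly_act C p v = 0\<^sub>v n"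
  proof (rule eq_vecI)
    fix r assume "r < dim_vec (0\<^sub>v n)"
    then have r: "r < n" by simp
    have "poly_act C p v $ r = (\<Sum>i<Suc n. c $ i * poly_act C (monom 1 i) v $ r)"
      unfolding p_def by (rule poly_act_sum_index[OF v r])
    also have "\<dots> = (A *\<^sub>v c) $ r"
      using r c(1) A by (auto simp: A_def scalar_prod_def atLeast0LessThan mult.commute intro!: sum.cong)
    also have "\<dots> = 0" using c(3) r by simp
    finally show "poly_act C p v $ r = 0\<^sub>v n $ r" using r by simp
  qed (use poly_act_carrier[OF v] in \<open>simp add: carrier_vecD\<close>)
  ultimately show ?thesis by blast
qed

end

section \<open>Annihilators of vectors\<close>

text \<open>Such an \<open>m\<close> generates the ideal of polynomials killing \<open>v\<close>. It
  is not normalised to be monic, hence a predicate that fixes it up to units.\<close>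

definition is_annihilator :: "nat \<Rightarrow> 'a::field_gcd mat \<Rightarrow> 'a vec \<Rightarrow> 'a poly \<Rightarrow> bool" where
  "is_annihilator n C v m \<longleftrightarrow> m \<noteq> 0 \<and> (\<forall>p. poly_act C p v = 0\<^sub>v n \<longleftrightarrow> m dvd p)"

context
  fixes C :: "'a::field_gcd mat" and n :: nat
  assumes C: "C \<in> carrier_mat n n"
begin

text \<open>Division with remainder: a nonzero annihilating polynomial of least degree divides all
  the others. The degree bound later guarantees that a largest degree exists.\<close>

lemma is_annihilator_exists:
  assumes v: "v \<in> carrier_vec n"
  shows "\<exists>m. is_annihilator n C v m \<and> degree m \<le> n"
proof -
  let ?P = "\<lambda>p. p \<noteq> 0 \<and> poly_act C p v = 0\<^sub>v n"
  obtain p where p: "?P p" "degree p \<le> n" using annihilating_poly_exists[OF C v] by blast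
  obtain m where m: "?P m" and min: "\<And>q. ?P q \<Longrightarrow> degree m \<le> degree q"
    using ex_has_least_nat[of ?P p degree] p(1) by blast
  have "m dvd q" if q: "poly_act C q v = 0\<^sub>v n" for q
  proof -
    have "poly_act C (q div m * m + q mod m) v = 0\<^sub>v n" using q by simp
    then have "poly_act C (q mod m) v = 0\<^sub>v n"
      using C v m by (simp only: poly_act_add[OF C] poly_act_mult[OF C]) simp
    then have "q mod m = 0" using min[of "q mod m"] degree_mod_less[of m q] m by linarith
    then show ?thesis by auto
  qed
  moreover have "poly_act C q v = 0\<^sub>v n" if "m dvd q" for q
  proof -
    from that obtain r where "q = r * m" by (metis dvd_def mult.commute)
    then show ?thesis using m C v by (simp add: poly_act_mult[OF C])
  qed
  ultimately have "is_annihilator n C v m" using m by (auto simp: is_annihilator_def)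
  moreover have "degree m \<le> n" using min[OF p(1)] p(2) by (rule le_trans)
  ultimately show ?thesis by blast
qed

text \<open>A polynomial \<open>p\<close> kills \<open>poly_act C b v\<close> iff
  \<open>p * b\<close> kills \<open>v\<close>, that is, iff \<open>a * b\<close> divides
  \<open>p * b\<close>; the nonzero \<open>b\<close> cancels.\<close>

lemma is_annihilator_poly_act:
  assumes v: "v \<in> carrier_vec n" and "is_annihilator n C v (a * b)"
  shows "is_annihilator n C (poly_act C b v) a"
  using assms by (auto simp: is_annihilator_def poly_act_mult[OF C v, symmetric])

text \<open>If \<open>p\<close> kills \<open>v + w\<close>, so does \<open>a * p\<close>, which
  kills \<open>v\<close> and therefore \<open>w\<close>. Thus \<open>b\<close> divides
  \<open>a * p\<close> and, by coprimality, \<open>p\<close>; symmetrically for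
  \<open>a\<close>.\<close>

lemma is_annihilator_add_coprime:
  assumes v: "v \<in> carrier_vec n" and w: "w \<in> carrier_vec n"
    and a: "is_annihilator n C v a" and b: "is_annihilator n C w b" and ab: "coprime a b"
  shows "is_annihilator n C (v + w) (a * b)"
proof -
  have z: "poly_act C p v = 0\<^sub>v n \<and> poly_act C p w = 0\<^sub>v n" if s: "poly_act C p (v + w) = 0\<^sub>v n" for p
  proof -
    have "poly_act C (a * p) (v + w) = 0\<^sub>v n" "poly_act C (b * p) (v + w) = 0\<^sub>v n"
      using s v w C by (simp_all add: poly_act_mult[OF C])
    moreover have "poly_act C (a * p) v = 0\<^sub>v n" "poly_act C (b * p) w = 0\<^sub>v n"
      using a b by (simp_all add: is_annihilator_def)
    ultimately have "poly_act C (a * p) w = 0\<^sub>v n" "poly_act C (b * p) v = 0\<^sub>v n"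
      using v w C by (simp_all add: poly_act_add_vec[OF C])
    then have "b dvd a * p" "a dvd b * p" using a b by (simp_all add: is_annihilator_def)
    then have "b dvd p" "a dvd p"
      using ab by (simp_all add: coprime_dvd_mult_right_iff coprime_commute)
    then show ?thesis using a b by (simp add: is_annihilator_def)
  qed
  have "poly_act C p (v + w) = 0\<^sub>v n \<longleftrightarrow> a dvd p \<and> b dvd p" for p
    using z[of p] a b poly_act_add_vec[OF C v w, of p] unfolding is_annihilator_def
    by (metis left_zero_vec zero_carrier_vec)
  moreover have "a dvd p \<and> b dvd p \<longleftrightarrow> a * b dvd p" for p
    using divides_mult[of a p b] dvd_mult_left[of a b p] dvd_mult_right[of a b p] ab by blast
  ultimately show ?thesis using a b by (simp add: is_annihilator_def)
qed

text \<open>Take \<open>v\<close> with an annihilator \<open>m\<close> of largest degree. If the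
  annihilator of some \<open>w\<close> contained a prime to a higher power than \<open>m\<close>,
  exchanging the prime-power parts would give a vector with a larger one. So \<open>m\<close> is the
  minimal polynomial of \<open>C\<close>.\<close>

lemma maximal_annihilator:
  "\<exists>v\<in>carrier_vec n. \<exists>m. is_annihilator n C v m \<and> (\<forall>w\<in>carrier_vec n. poly_act C m w = 0\<^sub>v n)"
proof -
  let ?Q = "\<lambda>d. \<exists>v\<in>carrier_vec n. \<exists>m. is_annihilator n C v m \<and> degree m = d"
  \<comment> \<open>An annihilator of \<open>v\<close> divides every polynomial that kills
    \<open>v\<close>, in particular one of degree at most \<open>n\<close>.\<close>
  have bound: "d \<le> n" if "?Q d" for d
  proof -
    from that obtain v m where v: "v \<in> carrier_vec n" and m: "is_annihilator n C v m" "degree m = d" by blast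
    obtain m' where m': "is_annihilator n C v m'" "degree m' \<le> n"
      using is_annihilator_exists[OF v] by blast
    then have "m dvd m'" using m(1) unfolding is_annihilator_def by (metis dvd_refl)
    then show ?thesis using m m' dvd_imp_degree_le[of m m'] by (simp add: is_annihilator_def)
  qed
  have "\<exists>d. ?Q d" using is_annihilator_exists[OF zero_carrier_vec] zero_carrier_vec by fast
  then obtain d where d: "?Q d" and max: "\<And>d'. ?Q d' \<Longrightarrow> d' \<le> d"
    using Nat.ex_has_greatest_nat[of ?Q _ n] bound by blast
  then obtain v m where v: "v \<in> carrier_vec n" and m: "is_annihilator n C v m" "degree m = d" by blast
  have "poly_act C m w = 0\<^sub>v n" if w: "w \<in> carrier_vec n" for w
  proof -
    obtain m' where m': "is_annihilator n C w m'" using is_annihilator_exists[OF w] by blast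
    have "m' dvd m"
    proof (rule multiplicity_le_imp_dvd)
      show "m' \<noteq> 0" using m' by (simp add: is_annihilator_def)
      fix p :: "'a poly" assume p: "prime p"
      show "multiplicity p m' \<le> multiplicity p m"
      proof (rule ccontr)
        assume "\<not> ?thesis"
        then have less: "multiplicity p m < multiplicity p m'" by simp
        have m0: "m \<noteq> 0" "m' \<noteq> 0" using m m' by (auto simp: is_annihilator_def)
        have pu: "\<not> is_unit p" using p not_prime_unit by blast
        obtain y i where y: "m = p ^ i * y" "\<not> p dvd y" and i: "i = multiplicity p m"
          using multiplicity_decompose'[OF m0(1) pu] by blast
        obtain z j where z: "m' = p ^ j * z" and j: "j = multiplicity p m'"
          using multiplicity_decompose'[OF m0(2) pu] by blast
        \<comment> \<open>these have the coprime annihilators \<open>y\<close> and \<open>p ^ j\<close>, so their sum beats the degree of \<open>m\<close>\<close>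
        let ?v = "poly_act C (p ^ i) v" and ?w = "poly_act C z w"
        have "is_annihilator n C ?v y"
          using m(1) y(1) by (intro is_annihilator_poly_act[OF v]) (simp add: mult.commute)
        moreover have "is_annihilator n C ?w (p ^ j)"
          using m' z by (intro is_annihilator_poly_act[OF w]) simp
        moreover have "coprime y (p ^ j)"
          using p y(2) by (metis coprime_commute coprime_power_right_iff prime_imp_coprime)
        ultimately have "is_annihilator n C (?v + ?w) (y * p ^ j)"
          using v w C by (intro is_annihilator_add_coprime) simp_all
        moreover have "?v + ?w \<in> carrier_vec n" using v w C by simp
        ultimately have "degree (y * p ^ j) \<le> degree m" using max m(2) by blast
        moreover have "p \<noteq> 0" "y \<noteq> 0" using p y(2) by auto
        \<comment> \<open>The factor \<open>y\<close> is common to both products, so only the powers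
          of \<open>p\<close> are compared.\<close>
        ultimately have "j * degree p \<le> i * degree p"
          by (simp add: y(1) degree_mult_eq degree_power_eq)
        moreover have "degree p > 0" using pu \<open>p \<noteq> 0\<close> is_unit_iff_degree by blast
        ultimately show False using less i j by simp
      qed
    qed
    then show ?thesis using m' by (simp add: is_annihilator_def)
  qed
  then show ?thesis using v m by blast
qed

end


section \<open>Dual vectors of a Krylov basis and the cyclic vector\<close>

lemma mat_vec_mult_eq_imp_eq:
  fixes A B :: "'a::semiring_1 mat"
  assumes A: "A \<in> carrier_mat n m" and B: "B \<in> carrier_mat n m"
    and eq: "\<And>y. y \<in> carrier_vec m \<Longrightarrow> A *\<^sub>v y = B *\<^sub>v y"
  shows "A = B"
proof (rule eq_matI)
  fix i j assume ij: "i < dim_row B" "j < dim_col B"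
  have "(A *\<^sub>v unit_vec m j) $ i = (B *\<^sub>v unit_vec m j) $ i" using eq by simp
  then show "A $$ (i, j) = B $$ (i, j)" using A B ij by (simp add: scalar_prod_right_unit)
qed (use A B in auto)

text \<open>The Gram matrix \<open>mat_adjoint K * K\<close> is invertible: for \<open>c\<close> in
  its kernel, \<open>K *\<^sub>v c\<close> has scalar product zero with itself. Its inverse times
  \<open>mat_adjoint K\<close> is the left inverse.\<close>

lemma left_inverse_exists:
  fixes K :: "'a::conjugatable_ordered_field mat"
  assumes K: "K \<in> carrier_mat n d"
    and inj: "\<And>c. c \<in> carrier_vec d \<Longrightarrow> K *\<^sub>v c = 0\<^sub>v n \<Longrightarrow> c = 0\<^sub>v d"
  shows "\<exists>B\<in>carrier_mat d n. B * K = 1\<^sub>m d"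
proof -
  let ?G = "mat_adjoint K * K"
  have G: "?G \<in> carrier_mat d d" using K by auto
  have "c = 0\<^sub>v d" if c: "c \<in> carrier_vec d" and z: "?G *\<^sub>v c = 0\<^sub>v d" for c
  proof -
    have Kc: "K *\<^sub>v c \<in> carrier_vec n" using K c by auto
    have "(K *\<^sub>v c) \<bullet>c (K *\<^sub>v c) = c \<bullet>c (mat_adjoint K *\<^sub>v (K *\<^sub>v c))"
      by (rule mult_mat_vec_cscalar_prod[OF K c Kc])
    also have "mat_adjoint K *\<^sub>v (K *\<^sub>v c) = 0\<^sub>v d"
      using K c z by (metis assoc_mult_mat_vec mat_adjoint_carrier)
    finally have "(K *\<^sub>v c) \<bullet>c (K *\<^sub>v c) = 0" using c by simp
    then show ?thesis using inj[OF c] Kc by simp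
  qed
  then have "det ?G \<noteq> 0" using det_0_iff_vec_prod_zero_field[OF G] by blast
  from det_non_zero_imp_unit[OF G this]
  obtain H where H: "H \<in> carrier_mat d d" "H * ?G = 1\<^sub>m d"
    by (auto simp: Units_def ring_mat_def)
  then have "(H * mat_adjoint K) * K = 1\<^sub>m d"
    using K by (metis assoc_mult_mat mat_adjoint_carrier)
  then show ?thesis using H K by (intro bexI[of _ "H * mat_adjoint K"]) auto
qed

context
  fixes C :: "'a::{conjugatable_ordered_field, field_gcd} mat" and n :: nat
  assumes C: "C \<in> carrier_mat n n"
begin

text \<open>A dependence among the first \<open>degree m\<close> Krylov vectors would be a nonzero
  annihilating polynomial of degree below that of \<open>m\<close>. So the Krylov matrix has a left
  inverse, and the rows of that are the dual vectors.\<close>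

lemma krylov_dual_vector:
  assumes v: "v \<in> carrier_vec n" and m: "is_annihilator n C v m" and k: "k < degree m"
  shows "\<exists>u\<in>carrier_vec n. \<forall>i<degree m. u \<bullet> poly_act C (monom 1 i) v = (if i = k then 1 else 0)"
proof -
  let ?d = "degree m"
  define K where "K = mat n ?d (\<lambda>(r, i). poly_act C (monom 1 i) v $ r)"
  have K: "K \<in> carrier_mat n ?d" by (simp add: K_def)
  have colK: "col K i = poly_act C (monom 1 i) v" if "i < ?d" for i
    using that C v by (intro eq_vecI) (auto simp: K_def carrier_vecD[OF poly_act_carrier[OF C v]])
  have "c = 0\<^sub>v ?d" if c: "c \<in> carrier_vec ?d" and z: "K *\<^sub>v c = 0\<^sub>v n" for c
  proof -
    define p where "p = (\<Sum>i<?d. monom (c $ i) i)"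
    have co: "coeff p j = (if j < ?d then c $ j else 0)" for j
      unfolding p_def by (rule coeff_sum_monom_lessThan)
    have "poly_act C p v = 0\<^sub>v n"
    proof (rule eq_vecI)
      fix r assume "r < dim_vec (0\<^sub>v n :: 'a vec)"
      then have r: "r < n" by simp
      have "poly_act C p v $ r = (\<Sum>i<?d. c $ i * poly_act C (monom 1 i) v $ r)"
        unfolding p_def by (rule poly_act_sum_index[OF C v r])
      also have "\<dots> = (K *\<^sub>v c) $ r"
        using r c K by (auto simp: K_def scalar_prod_def atLeast0LessThan mult.commute intro!: sum.cong)
      finally show "poly_act C p v $ r = 0\<^sub>v n $ r" using z by simp
    qed (use poly_act_carrier[OF C v] in \<open>simp add: carrier_vecD\<close>)
    then have "m dvd p" using m by (simp add: is_annihilator_def)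
    \<comment> \<open>The bound on \<open>k\<close> makes \<open>?d\<close> positive, so the strict
      inequality also covers \<open>p = 0\<close>, whose degree is 0.\<close>
    moreover have "degree p < ?d"
      using k by (intro degree_lessI) (auto simp: co)
    ultimately have "p = 0" using dvd_imp_degree_le[of m p] by fastforce
    then have "c $ j = 0" if "j < ?d" for j using co[of j] that by simp
    then show ?thesis using c by (intro eq_vecI) auto
  qed
  then obtain B where B: "B \<in> carrier_mat ?d n" "B * K = 1\<^sub>m ?d"
    using left_inverse_exists[OF K] by blast
  have "row B k \<bullet> poly_act C (monom 1 i) v = (if i = k then 1 else 0)" if i: "i < ?d" for i
  proof -
    have "row B k \<bullet> poly_act C (monom 1 i) v = (B * K) $$ (k, i)"
      using B(1) K i k by (simp add: colK)
    then show ?thesis using B(2) i k by simp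
  qed
  then show ?thesis using B(1) k by (intro bexI[of _ "row B k"]) auto
qed

text \<open>
  The matrix is \<open>D = \<Sum> p\<^sub>k C\<^sup>j w u\<^sup>T C\<^sup>i\<close>, summed over \<open>k\<close> and all \<open>i, j\<close> with \<open>i + j = k - 1\<close>: in
  \<open>D C - C D\<close> the sums for fixed \<open>k\<close> telescope.
  If \<open>p(C) = 0\<close> then \<open>D\<close> commutes with \<open>C\<close>, and for a dual vector \<open>u\<close> of the Krylov basis of \<open>v\<close> it maps
  \<open>v\<close> to a multiple of \<open>w\<close>.
\<close>

lemma commutator_solution:
  assumes u: "u \<in> carrier_vec n" and w: "w \<in> carrier_vec n"
  shows "\<exists>D\<in>carrier_mat n n.
    (\<forall>y\<in>carrier_vec n. D *\<^sub>v (C *\<^sub>v y) + (u \<bullet> y) \<cdot>\<^sub>v poly_act C p w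
        = C *\<^sub>v (D *\<^sub>v y) + (u \<bullet> poly_act C p y) \<cdot>\<^sub>v w) \<and>
    (\<forall>v\<in>carrier_vec n. \<forall>k. degree p \<le> Suc k \<longrightarrow> (\<forall>i<k. u \<bullet> poly_act C (monom 1 i) v = 0) \<longrightarrow>
        D *\<^sub>v v = (coeff p (Suc k) * (u \<bullet> poly_act C (monom 1 k) v)) \<cdot>\<^sub>v w)"
proof (induction p)
  case 0
  have z: "0\<^sub>m n n *\<^sub>v y = 0\<^sub>v n" "C *\<^sub>v 0\<^sub>v n = 0\<^sub>v n" if "y \<in> carrier_vec n" for y :: "'a vec"
    using C that by (auto intro!: eq_vecI)
  have "0 \<cdot>\<^sub>v w = 0\<^sub>v n" using w by auto
  then show ?case using C u w by (intro bexI[of _ "0\<^sub>m n n"]) (auto simp: z)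
next
  case (pCons a q)
  then obtain D where D: "D \<in> carrier_mat n n"
    and D1: "\<And>y. y \<in> carrier_vec n \<Longrightarrow> D *\<^sub>v (C *\<^sub>v y) + (u \<bullet> y) \<cdot>\<^sub>v poly_act C q w
        = C *\<^sub>v (D *\<^sub>v y) + (u \<bullet> poly_act C q y) \<cdot>\<^sub>v w"
    and D2: "\<And>v k. v \<in> carrier_vec n \<Longrightarrow> degree q \<le> Suc k \<Longrightarrow>
        (\<And>i. i < k \<Longrightarrow> u \<bullet> poly_act C (monom 1 i) v = 0) \<Longrightarrow>
        D *\<^sub>v v = (coeff q (Suc k) * (u \<bullet> poly_act C (monom 1 k) v)) \<cdot>\<^sub>v w"
    by blast
  \<comment> \<open>For \<open>pCons a q\<close> the summands with \<open>i = 0\<close> add up to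
    q(C) w u^T, which is \<open>E\<close>; those with \<open>i > 0\<close> form the matrix for
    \<open>q\<close> times \<open>C\<close>. Hence the recursion \<open>E + D * C\<close>.\<close>
  define E where "E = mat n n (\<lambda>(i, j). poly_act C q w $ i * u $ j)"
  have E: "E \<in> carrier_mat n n" by (simp add: E_def)
  have qw: "poly_act C q w \<in> carrier_vec n" using C w by simp
  have Ey: "E *\<^sub>v y = (u \<bullet> y) \<cdot>\<^sub>v poly_act C q w" if y: "y \<in> carrier_vec n" for y
    using y u qw by (intro eq_vecI) (auto simp: E_def scalar_prod_def sum_distrib_left mult_ac
        intro!: sum.cong)
  let ?D = "E + D * C"
  have DC: "D * C \<in> carrier_mat n n" using C D by simp
  have Dy: "?D *\<^sub>v y = (u \<bullet> y) \<cdot>\<^sub>v poly_act C q w + D *\<^sub>v (C *\<^sub>v y)" if y: "y \<in> carrier_vec n" for y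
    using C D E y by (subst add_mult_distrib_mat_vec[OF E DC y]) (simp add: Ey assoc_mult_mat_vec[of _ n n])
  have comm: "?D *\<^sub>v (C *\<^sub>v y) + (u \<bullet> y) \<cdot>\<^sub>v poly_act C (pCons a q) w
      = C *\<^sub>v (?D *\<^sub>v y) + (u \<bullet> poly_act C (pCons a q) y) \<cdot>\<^sub>v w" if y: "y \<in> carrier_vec n" for y
  proof -
    have Cy: "C *\<^sub>v y \<in> carrier_vec n" using C y by simp
    have qCy: "poly_act C q (C *\<^sub>v y) = C *\<^sub>v poly_act C q y"
      using C y by (metis mult.commute poly_act_X poly_act_carrier poly_act_mult)
    let ?P = "poly_act C q w" and ?s = "u \<bullet> y" and ?t = "u \<bullet> (C *\<^sub>v y)"
    have "D *\<^sub>v (C *\<^sub>v (C *\<^sub>v y)) + ?t \<cdot>\<^sub>v ?P = C *\<^sub>v (D *\<^sub>v (C *\<^sub>v y)) + (u \<bullet> (C *\<^sub>v poly_act C q y)) \<cdot>\<^sub>v w"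
      using D1[OF Cy] by (simp add: qCy)
    moreover have "C *\<^sub>v (?s \<cdot>\<^sub>v ?P + D *\<^sub>v (C *\<^sub>v y)) = ?s \<cdot>\<^sub>v (C *\<^sub>v ?P) + C *\<^sub>v (D *\<^sub>v (C *\<^sub>v y))"
      using C D qw y by (subst mult_add_distrib_mat_vec[OF C]) (auto simp: mult_mat_vec[OF C])
    moreover have "u \<bullet> (a \<cdot>\<^sub>v y + C *\<^sub>v poly_act C q y) = a * ?s + u \<bullet> (C *\<^sub>v poly_act C q y)"
      using C u y by (subst scalar_prod_add_distrib[of _ n]) auto
    \<comment> \<open>Here \<open>P\<close>, \<open>Q\<close>, \<open>x\<close>, \<open>z\<close>
      stand for q(C) w, C q(C) w, D C C y and C D C y. The constant coefficient \<open>a\<close>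
      contributes the same multiple of \<open>w\<close> to both sides.\<close>
    moreover have "(t \<cdot>\<^sub>v P + x) + s \<cdot>\<^sub>v (a \<cdot>\<^sub>v w + Q) = (s \<cdot>\<^sub>v Q + z) + (a * s + r) \<cdot>\<^sub>v w"
      if "P \<in> carrier_vec n" "Q \<in> carrier_vec n" "x \<in> carrier_vec n" "z \<in> carrier_vec n"
        and eq: "x + t \<cdot>\<^sub>v P = z + r \<cdot>\<^sub>v w" for P Q x z :: "'a vec" and r s t
    proof (rule eq_vecI)
      fix i assume "i < dim_vec ((s \<cdot>\<^sub>v Q + z) + (a * s + r) \<cdot>\<^sub>v w)"
      then have i: "i < n" using w by simp
      have "x $ i + t * P $ i = z $ i + r * w $ i"
        using arg_cong[OF eq, of "\<lambda>v. v $ i"] that(1-4) w i by simp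
      then have "t * P $ i + x $ i = z $ i + r * w $ i" by (simp add: add.commute)
      then show "((t \<cdot>\<^sub>v P + x) + s \<cdot>\<^sub>v (a \<cdot>\<^sub>v w + Q)) $ i = ((s \<cdot>\<^sub>v Q + z) + (a * s + r) \<cdot>\<^sub>v w) $ i"
        using that(1-4) w i by (simp add: distrib_left distrib_right mult_ac)
    qed (use that(1-4) w in auto)
    ultimately show ?thesis
      unfolding Dy[OF y] Dy[OF Cy] poly_act_pCons[OF C y] poly_act_pCons[OF C w]
      using C D qw y by simp
  qed
  \<comment> \<open>On \<open>v\<close> only summands with \<open>i = k\<close> can survive; by the
    degree bound these have \<open>j = 0\<close> and the coefficient of degree
    \<open>Suc k\<close>.\<close>
  have val: "?D *\<^sub>v v = (coeff (pCons a q) (Suc k) * (u \<bullet> poly_act C (monom 1 k) v)) \<cdot>\<^sub>v w"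
    if v: "v \<in> carrier_vec n" and k: "degree (pCons a q) \<le> Suc k"
      and z: "\<And>i. i < k \<Longrightarrow> u \<bullet> poly_act C (monom 1 i) v = 0" for v k
  proof -
    have dq: "degree q \<le> k" using k by (auto split: if_splits)
    have Cv: "C *\<^sub>v v \<in> carrier_vec n" using C v by simp
    have m0: "poly_act C (monom 1 0) v = v" using C v by (simp add: monom_0 poly_act_const[OF C v])
    show ?thesis
    proof (cases k)
      case 0
      then obtain b where b: "q = [:b:]" using dq degree_eq_zeroE[of q] by blast
      \<comment> \<open>The constant \<open>q\<close> has no coefficient of degree 1, so
        \<open>D\<close> kills \<open>C *\<^sub>v v\<close> and only \<open>E\<close>
        contributes.\<close>
      have "D *\<^sub>v (C *\<^sub>v v) = (coeff q (Suc 0) * (u \<bullet> poly_act C (monom 1 0) (C *\<^sub>v v))) \<cdot>\<^sub>v w"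
        using dq 0 by (intro D2[OF Cv]) auto
      then have "D *\<^sub>v (C *\<^sub>v v) = 0\<^sub>v n" using b w by auto
      then show ?thesis using v C w m0 0 unfolding Dy[OF v]
        by (simp add: b poly_act_const[OF C] smult_smult_assoc mult_ac)
    next
      case (Suc l)
      \<comment> \<open>The hypothesis for \<open>q\<close> is applied at
        \<open>C *\<^sub>v v\<close>, which lowers the index from \<open>k\<close> to
        \<open>l\<close>; the term from \<open>E\<close> vanishes because
        \<open>u \<bullet> v = 0\<close>.\<close>
      have "D *\<^sub>v (C *\<^sub>v v) = (coeff q (Suc l) * (u \<bullet> poly_act C (monom 1 l) (C *\<^sub>v v))) \<cdot>\<^sub>v w"
        using z dq Suc by (intro D2[OF Cv]) (auto simp: poly_act_monom_Suc[OF C v, symmetric])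
      moreover have "u \<bullet> v = 0" using z[of 0] Suc m0 by simp
      moreover have "0 \<cdot>\<^sub>v poly_act C q w + x \<cdot>\<^sub>v w = x \<cdot>\<^sub>v w" for x
        using qw w by (intro eq_vecI) auto
      ultimately show ?thesis using Suc unfolding Dy[OF v]
        by (simp add: poly_act_monom_Suc[OF C v])
    qed
  qed
  show ?case
  proof (intro bexI[of _ ?D] conjI ballI allI impI)
    fix v :: "'a vec" and k assume "v \<in> carrier_vec n" "degree (pCons a q) \<le> Suc k"
      "\<forall>i<k. u \<bullet> poly_act C (monom 1 i) v = 0"
    then show "?D *\<^sub>v v = (coeff (pCons a q) (Suc k) * (u \<bullet> poly_act C (monom 1 k) v)) \<cdot>\<^sub>v w"
      by (intro val) blast+
  qed (fact comm, use E DC in simp)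
qed

text \<open>In \<open>commutator_solution\<close> take for \<open>p\<close> the polynomial
  \<open>m\<close> of \<open>maximal_annihilator\<close> and for \<open>u\<close> the dual of the
  last Krylov vector. As \<open>m\<close> kills all vectors, \<open>D\<close> commutes with
  \<open>C\<close>; it sends \<open>v\<close> to the leading coefficient of \<open>m\<close> times
  \<open>w\<close>.\<close>

theorem commutant_cyclic_vector:
  "\<exists>v\<in>carrier_vec n. \<forall>w\<in>carrier_vec n. \<exists>X\<in>commutant n {C}. X *\<^sub>v v = w"
proof -
  obtain v m where v: "v \<in> carrier_vec n" and m: "is_annihilator n C v m"
    and m0: "\<And>w. w \<in> carrier_vec n \<Longrightarrow> poly_act C m w = 0\<^sub>v n"
    using maximal_annihilator[OF C] by blast
  have "\<exists>X\<in>commutant n {C}. X *\<^sub>v v = w" if w: "w \<in> carrier_vec n" for w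
  proof (cases "degree m")
    case 0
    then obtain b where b: "m = [:b:]" "b \<noteq> 0"
      using m degree_eq_zeroE[of m] by (auto simp: is_annihilator_def)
    \<comment> \<open>A nonzero constant kills every vector only in dimension zero; there
      \<open>C\<close> itself maps \<open>v\<close> to \<open>w\<close>.\<close>
    have "x = 0\<^sub>v n" if x: "x \<in> carrier_vec n" for x :: "'a vec"
    proof -
      have "b \<cdot>\<^sub>v x = 0\<^sub>v n" using m0[OF x] b poly_act_const[OF C x] by simp
      then have "b * x $ i = 0" if "i < n" for i
        using that x by (metis carrier_vecD index_smult_vec(1) index_zero_vec(1))
      then show ?thesis using b x by (intro eq_vecI) auto
    qed
    then have "C *\<^sub>v v = w" using w C v by (metis mult_mat_vec_carrier)
    then show ?thesis using C by (intro bexI[of _ C]) (auto simp: commutant_def)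
  next
    case (Suc k)
    then obtain u where u: "u \<in> carrier_vec n"
      and dual: "\<And>i. i \<le> k \<Longrightarrow> u \<bullet> poly_act C (monom 1 i) v = (if i = k then 1 else 0)"
      using krylov_dual_vector[OF v m, of k] by auto
    obtain D where D: "D \<in> carrier_mat n n"
      and D1: "\<And>y. y \<in> carrier_vec n \<Longrightarrow> D *\<^sub>v (C *\<^sub>v y) + (u \<bullet> y) \<cdot>\<^sub>v poly_act C m w
          = C *\<^sub>v (D *\<^sub>v y) + (u \<bullet> poly_act C m y) \<cdot>\<^sub>v w"
      and D2: "\<And>v k. v \<in> carrier_vec n \<Longrightarrow> degree m \<le> Suc k \<Longrightarrow>
        (\<And>i. i < k \<Longrightarrow> u \<bullet> poly_act C (monom 1 i) v = 0) \<Longrightarrow>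
        D *\<^sub>v v = (coeff m (Suc k) * (u \<bullet> poly_act C (monom 1 k) v)) \<cdot>\<^sub>v w"
      using commutator_solution[OF u w, of m] by blast
    have "D *\<^sub>v (C *\<^sub>v y) = C *\<^sub>v (D *\<^sub>v y)" if y: "y \<in> carrier_vec n" for y
    proof -
      have "(u \<bullet> y) \<cdot>\<^sub>v poly_act C m w = 0\<^sub>v n" "(u \<bullet> poly_act C m y) \<cdot>\<^sub>v w = 0\<^sub>v n"
        using m0[OF w] m0[OF y] u w by auto
      then show ?thesis using D1[OF y] C D y by simp
    qed
    then have "D * C = C * D"
      using C D by (intro mat_vec_mult_eq_imp_eq[of _ n n]) auto
    define c where "c = coeff m (Suc k)"
    have "c \<noteq> 0" using Suc m by (metis c_def is_annihilator_def leading_coeff_0_iff)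
    have Dv: "D *\<^sub>v v = c \<cdot>\<^sub>v w" using D2[OF v, of k] dual Suc by (simp add: c_def)
    have "(inverse c \<cdot>\<^sub>m D) *\<^sub>v v = inverse c \<cdot>\<^sub>v (D *\<^sub>v v)"
      using D v by (intro eq_vecI) auto
    also have "\<dots> = w" using \<open>c \<noteq> 0\<close> by (simp add: Dv smult_smult_assoc)
    finally have "(inverse c \<cdot>\<^sub>m D) *\<^sub>v v = w" .
    moreover have "inverse c \<cdot>\<^sub>m D \<in> commutant n {C}"
      using C D \<open>D * C = C * D\<close> by (auto simp: commutant_def mult_smult_distrib mult_smult_assoc_mat)
    ultimately show ?thesis by blast
  qed
  then show ?thesis using v by blast
qed

end

section \<open>Equivariance under the commutant\<close>

lemma sum_lessThan_mult:
  fixes g :: "nat \<Rightarrow> nat \<Rightarrow> 'b::comm_monoid_add"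
  shows "(\<Sum>k<m * n. g (k div n) (k mod n)) = (\<Sum>i<m. \<Sum>j<n. g i j)"
proof (induction m)
  case (Suc m)
  have "(\<Sum>k<Suc m * n. g (k div n) (k mod n))
      = (\<Sum>k<m * n. g (k div n) (k mod n)) + (\<Sum>k = m * n..<m * n + n. g (k div n) (k mod n))"
    by (simp add: lessThan_atLeast0 sum.atLeastLessThan_concat add.commute)
  also have "(\<Sum>k = m * n..<m * n + n. g (k div n) (k mod n)) = (\<Sum>j<n. g m j)"
    using sum.shift_bounds_nat_ivl[of "\<lambda>k. g (k div n) (k mod n)" 0 "m * n" n]
    by (auto simp: lessThan_atLeast0 add.commute intro!: sum.cong)
  finally show ?case using Suc by simp
qed simp

lemma kronecker_carrier [simp]:
  "A \<in> carrier_mat m n \<Longrightarrow> B \<in> carrier_mat p q \<Longrightarrow> kronecker A B \<in> carrier_mat (m * p) (n * q)"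
  by (auto simp: kronecker_def)

lemma kronecker_mult:
  fixes A B C D :: "'a::comm_semiring_1 mat"
  assumes A: "A \<in> carrier_mat n n" and B: "B \<in> carrier_mat n n"
    and C: "C \<in> carrier_mat n n" and D: "D \<in> carrier_mat n n"
  shows "kronecker A B * kronecker C D = kronecker (A * C) (B * D)"
proof (rule eq_matI)
  fix i j assume "i < dim_row (kronecker (A * C) (B * D))" "j < dim_col (kronecker (A * C) (B * D))"
  then have i: "i < n * n" and j: "j < n * n" using assms by (auto simp: kronecker_def)
  then have n: "n > 0" by (cases n) auto
  have b: "i div n < n" "j div n < n" "i mod n < n" "j mod n < n"
    using i j n by (auto simp: less_mult_imp_div_less)
  have "(kronecker A B * kronecker C D) $$ (i, j) =
      (\<Sum>k<n * n. (A $$ (i div n, k div n) * C $$ (k div n, j div n))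
         * (B $$ (i mod n, k mod n) * D $$ (k mod n, j mod n)))"
    using assms i j by (auto simp: kronecker_def scalar_prod_def lessThan_atLeast0 mult_ac intro!: sum.cong)
  also have "\<dots> = (\<Sum>k<n. A $$ (i div n, k) * C $$ (k, j div n))
      * (\<Sum>k<n. B $$ (i mod n, k) * D $$ (k, j mod n))"
    by (subst sum_lessThan_mult[of "\<lambda>k l. (A $$ (i div n, k) * C $$ (k, j div n))
         * (B $$ (i mod n, l) * D $$ (l, j mod n))"]) (simp add: sum_product)
  also have "\<dots> = kronecker (A * C) (B * D) $$ (i, j)"
    using assms i j b by (auto simp: kronecker_def scalar_prod_def lessThan_atLeast0)
  finally show "(kronecker A B * kronecker C D) $$ (i, j) = kronecker (A * C) (B * D) $$ (i, j)" .
qed (use assms in \<open>auto simp: kronecker_def\<close>)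

lemma map_mat_conjugate_mult:
  fixes A B :: "'a::conjugatable_ring mat"
  assumes "A \<in> carrier_mat m n" "B \<in> carrier_mat n p"
  shows "map_mat conjugate (A * B) = map_mat conjugate A * map_mat conjugate B"
  using assms by (intro eq_matI) (auto simp: scalar_prod_def sum_conjugate conjugate_dist_mul)

lemma vec_cols_carrier: "V \<in> carrier_mat m n \<Longrightarrow> vec_cols V \<in> carrier_vec (m * n)"
  by (auto simp: vec_cols_def)

lemma vec_cols_inject:
  assumes A: "A \<in> carrier_mat n n" and B: "B \<in> carrier_mat n n" and eq: "vec_cols A = vec_cols B"
  shows "A = B"
proof (rule eq_matI)
  fix i j assume "i < dim_row B" "j < dim_col B"
  then have i: "i < n" and j: "j < n" using B by auto
  have "j * n + i < Suc j * n" using i by simp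
  also have "\<dots> \<le> n * n" using j by (intro mult_le_mono1) simp
  finally have "j * n + i < n * n" .
  then show "A $$ (i, j) = B $$ (i, j)"
    using arg_cong[OF eq, of "\<lambda>v. v $ (j * n + i)"] A B i by (simp add: vec_cols_def)
qed (use A B in auto)

text \<open>Under column stacking, V mapped to X V B becomes the Kronecker product of the transpose
  of B with X. For \<open>B = mat_adjoint Z\<close> this transpose is the entrywise conjugate of
  \<open>Z\<close>, which is why the left factor is conjugated.\<close>

lemma kronecker_vec_cols:
  fixes X Z V :: "'a::conjugatable_field mat"
  assumes X: "X \<in> carrier_mat n n" and Z: "Z \<in> carrier_mat n n" and V: "V \<in> carrier_mat n n"
  shows "kronecker (map_mat conjugate Z) X *\<^sub>v vec_cols V = vec_cols (X * V * mat_adjoint Z)"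
proof (rule eq_vecI)
  fix i assume "i < dim_vec (vec_cols (X * V * mat_adjoint Z))"
  then have i: "i < n * n" using assms by (simp add: vec_cols_def)
  then have n: "n > 0" by (cases n) auto
  have b: "i div n < n" "i mod n < n"
    using i n by (auto simp: less_mult_imp_div_less)
  have "(kronecker (map_mat conjugate Z) X *\<^sub>v vec_cols V) $ i
      = (\<Sum>k<n * n. conjugate (Z $$ (i div n, k div n)) * X $$ (i mod n, k mod n) * V $$ (k mod n, k div n))"
    using assms i b n by (auto simp: kronecker_def vec_cols_def scalar_prod_def lessThan_atLeast0
      less_mult_imp_div_less intro!: sum.cong)
  also have "\<dots> = (\<Sum>l<n. \<Sum>k<n. conjugate (Z $$ (i div n, l)) * X $$ (i mod n, k) * V $$ (k, l))"
    by (rule sum_lessThan_mult)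
  also have "\<dots> = vec_cols (X * V * mat_adjoint Z) $ i"
    using assms i b by (auto simp: vec_cols_def scalar_prod_def lessThan_atLeast0
      sum_distrib_left sum_distrib_right mult_ac intro!: sum.cong)
  finally show "(kronecker (map_mat conjugate Z) X *\<^sub>v vec_cols V) $ i = vec_cols (X * V * mat_adjoint Z) $ i" .
qed (use assms in \<open>auto simp: kronecker_def vec_cols_def\<close>)

text \<open>The matrices commuting with \<open>K\<close> form a subspace, so the generators decide.
  The carrier part of the conclusion is used later, with the identity for \<open>K\<close>, to read
  off the size of \<open>M\<close>.\<close>

lemma span_module_mat_commute:
  fixes S :: "'a::field mat set"
  assumes K: "K \<in> carrier_mat n n" and S: "S \<subseteq> carrier_mat n n"
    and comm: "\<And>A. A \<in> S \<Longrightarrow> A * K = K * A"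
    and M: "M \<in> LinearCombinations.module.span class_ring (module_mat TYPE('a) n n) S"
  shows "M \<in> carrier_mat n n \<and> M * K = K * M"
proof -
  interpret vectorspace "class_ring :: 'a ring" "module_mat TYPE('a) n n" by (rule matrix_vs)
  obtain a A where A: "finite A" "A \<subseteq> S" and M: "M = lincomb a A"
    using M unfolding span_def by blast
  show ?thesis unfolding M using A
  proof (induction A rule: finite_induct)
    case empty
    then show ?case using K by (simp add: lincomb_def finsum_empty module_mat_simps)
  next
    case (insert x A)
    have x: "x \<in> carrier_mat n n" using insert.prems S by auto
    have "lincomb a (insert x A) = a x \<cdot>\<^sub>m x + lincomb a A"
      using insert.hyps insert.prems S
      by (subst lincomb_insert2) (auto simp: module_mat_simps class_ring_simps)
    moreover have "(c \<cdot>\<^sub>m x + B) * K = K * (c \<cdot>\<^sub>m x + B)"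
      if "B \<in> carrier_mat n n" "B * K = K * B" for c B
      using that x K comm[of x] insert.prems
      by (simp add: add_mult_distrib_mat[of _ n n _ K n] mult_add_distrib_mat[of K n n _ n]
          mult_smult_distrib[of _ n n _ n] mult_smult_assoc_mat[of _ n n _ n])
    ultimately show ?case using insert x by simp
  qed
qed

text \<open>Elements of the bicommutant commute with \<open>X\<close> and \<open>Z\<close>, and
  entrywise conjugation is multiplicative, so by \<open>kronecker_mult\<close> every generator of
  the tensor space commutes with \<open>?K\<close>. Hence \<open>L\<close> does, and unstacking
  gives the identity.\<close>

lemma tensor_space_equivariant:
  fixes f :: "'a::conjugatable_field mat \<Rightarrow> 'a mat"
  assumes f: "is_matricization n n f L" and fc: "\<And>V. V \<in> carrier_mat n n \<Longrightarrow> f V \<in> carrier_mat n n"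
    and L: "L \<in> tensor_space n (map_mat conjugate ` bicommutant n C) (bicommutant n C)"
    and X: "X \<in> commutant n {C}" and Z: "Z \<in> commutant n {C}" and V: "V \<in> carrier_mat n n"
  shows "f (X * V * mat_adjoint Z) = X * f V * mat_adjoint Z"
proof -
  let ?K = "kronecker (map_mat conjugate Z) X"
  have Xc: "X \<in> carrier_mat n n" and Zc: "Z \<in> carrier_mat n n" using X Z by (auto simp: commutant_def)
  have K: "?K \<in> carrier_mat (n^2) (n^2)" using Xc Zc by (simp add: power2_eq_square)
  have bic: "A \<in> carrier_mat n n" "A * Y = Y * A" if "A \<in> bicommutant n C" "Y \<in> commutant n {C}" for A Y
    using that by (auto simp: bicommutant_def commutant_def)
  have LK: "L \<in> carrier_mat (n^2) (n^2) \<and> L * ?K = ?K * L"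
  proof (rule span_module_mat_commute[OF K _ _ L[unfolded tensor_space_def]])
    show "{kronecker A B |A B. A \<in> map_mat conjugate ` bicommutant n C \<and> B \<in> bicommutant n C}
        \<subseteq> carrier_mat (n\<^sup>2) (n\<^sup>2)"
      using bic(1)[OF _ X] by (auto simp: power2_eq_square)
    fix T assume "T \<in> {kronecker A B |A B. A \<in> map_mat conjugate ` bicommutant n C \<and> B \<in> bicommutant n C}"
    then obtain A B where T: "T = kronecker (map_mat conjugate A) B"
      and A: "A \<in> bicommutant n C" and B: "B \<in> bicommutant n C" by auto
    have Ac: "A \<in> carrier_mat n n" and Bc: "B \<in> carrier_mat n n"
      using bic(1)[OF A X] bic(1)[OF B X] .
    show "T * ?K = ?K * T" unfolding T
      using Ac Bc Xc Zc bic(2)[OF A Z] bic(2)[OF B X]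
      by (simp add: kronecker_mult[where n = n] map_mat_conjugate_mult[symmetric, of _ n n])
  qed
  have M: "L *\<^sub>v vec_cols V = vec_cols (f V)" if "V \<in> carrier_mat n n" for V
    using f that by (auto simp: is_matricization_def)
  have Wc: "X * V * mat_adjoint Z \<in> carrier_mat n n" "X * f V * mat_adjoint Z \<in> carrier_mat n n"
    using Xc Zc V fc[OF V] by auto
  have Vv: "vec_cols V \<in> carrier_vec (n^2)" using vec_cols_carrier[OF V] by (simp add: power2_eq_square)
  have "vec_cols (f (X * V * mat_adjoint Z)) = L *\<^sub>v (?K *\<^sub>v vec_cols V)"
    using M[OF Wc(1)] by (simp add: kronecker_vec_cols[OF Xc Zc V])
  also have "\<dots> = (L * ?K) *\<^sub>v vec_cols V"
    using LK K Vv by (intro assoc_mult_mat_vec[symmetric]) auto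
  also have "\<dots> = ?K *\<^sub>v (L *\<^sub>v vec_cols V)"
    using LK K Vv by (metis assoc_mult_mat_vec)
  also have "\<dots> = vec_cols (X * f V * mat_adjoint Z)"
    by (simp add: M[OF V] kronecker_vec_cols[OF Xc Zc fc[OF V]])
  finally show ?thesis using vec_cols_inject fc[OF Wc(1)] Wc(2) by blast
qed

section \<open>Complete positivity\<close>

lemma star_linearD:
  fixes f :: "'a::conjugatable_field mat \<Rightarrow> 'a mat"
  assumes "star_linear q n f"
  shows "V \<in> carrier_mat q q \<Longrightarrow> f V \<in> carrier_mat n n"
    and "V \<in> carrier_mat q q \<Longrightarrow> W \<in> carrier_mat q q \<Longrightarrow> f (V + W) = f V + f W"
    and "V \<in> carrier_mat q q \<Longrightarrow> f (c \<cdot>\<^sub>m V) = c \<cdot>\<^sub>m f V"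
proof -
  have "f \<in> LinearCombinations.module_hom class_ring (module_mat TYPE('a) q q) (module_mat TYPE('a) n n)"
    using assms unfolding star_linear_def linear_map_def mod_hom_def mod_hom_axioms_def by blast
  then show "V \<in> carrier_mat q q \<Longrightarrow> f V \<in> carrier_mat n n"
    and "V \<in> carrier_mat q q \<Longrightarrow> W \<in> carrier_mat q q \<Longrightarrow> f (V + W) = f V + f W"
    and "V \<in> carrier_mat q q \<Longrightarrow> f (c \<cdot>\<^sub>m V) = c \<cdot>\<^sub>m f V"
    by (auto simp: LinearCombinations.module_hom_def module_mat_simps class_ring_simps)
qed

lemma block_index_less:
  assumes "(a::nat) < k" "i < n"
  shows "a * n + i < k * n"
proof -
  have "a * n + i < Suc a * n" using assms by simp
  also have "\<dots> \<le> k * n" using assms by (intro mult_le_mono1) simp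
  finally show ?thesis .
qed

lemma mat_block_carrier [simp]: "mat_block q V a b \<in> carrier_mat q q"
  by (simp add: mat_block_def)

lemma mat_block_add_smult:
  assumes "V \<in> carrier_mat (k * n) (k * n)" "W \<in> carrier_mat (k * n) (k * n)" "a < k" "b < k"
  shows "mat_block n (V + c \<cdot>\<^sub>m W) a b = mat_block n V a b + c \<cdot>\<^sub>m mat_block n W a b"
  using assms by (intro eq_matI) (auto simp: mat_block_def block_index_less)

text \<open>Equivariance, applied block by block, assembles into one congruence of the fixed matrix
  \<open>f (outer n v)\<close>. The set \<open>S\<close> will be the commutant of
  \<open>C\<close>.\<close>

lemma block_map_outer:
  fixes f :: "'a::conjugatable_field mat \<Rightarrow> 'a mat"
  assumes fc: "\<And>V. V \<in> carrier_mat n n \<Longrightarrow> f V \<in> carrier_mat n n"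
    and S: "S \<subseteq> carrier_mat n n" and v: "v \<in> carrier_vec n"
    and cyclic: "\<And>w. w \<in> carrier_vec n \<Longrightarrow> \<exists>X\<in>S. X *\<^sub>v v = w"
    and equiv: "\<And>X Z V. X \<in> S \<Longrightarrow> Z \<in> S \<Longrightarrow> V \<in> carrier_mat n n \<Longrightarrow>
      f (X * V * mat_adjoint Z) = X * f V * mat_adjoint Z"
  shows "\<exists>Y\<in>carrier_mat (k * n) n. block_map k n n f (outer (k * n) u) = Y * f (outer n v) * mat_adjoint Y"
proof -
  \<comment> \<open>\<open>X a\<close> carries \<open>v\<close> to the \<open>a\<close>-th segment
    of length \<open>n\<close> of \<open>u\<close>; the indices below \<open>k\<close> are those
    that enter \<open>Y\<close>.\<close>
  have "\<forall>a. \<exists>X. X \<in> S \<and> X *\<^sub>v v = vec n (\<lambda>i. u $ (a * n + i))"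
    using cyclic[OF vec_carrier] by blast
  from choice[OF this] obtain X where
    X: "\<And>a. X a \<in> S" "\<And>a. X a *\<^sub>v v = vec n (\<lambda>i. u $ (a * n + i))"
    by blast
  have Xc: "X a \<in> carrier_mat n n" for a using X(1) S by blast
  define Y where "Y = mat (k * n) n (\<lambda>(I, l). X (I div n) $$ (I mod n, l))"
  have Yc: "Y \<in> carrier_mat (k * n) n" by (simp add: Y_def)
  let ?P = "f (outer n v)"
  have P: "?P \<in> carrier_mat n n" by (simp add: fc)
  have block: "mat_block n (outer (k * n) u) a b = X a * outer n v * mat_adjoint (X b)"
    if ab: "a < k" "b < k" for a b
  proof (rule mat_vec_mult_eq_imp_eq[of _ n n])
    fix y :: "'a vec" assume y: "y \<in> carrier_vec n"
    let ?u = "\<lambda>a. vec n (\<lambda>i. u $ (a * n + i))"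
    have "mat_block n (outer (k * n) u) a b = mat n n (\<lambda>(i, j). ?u a $ i * conjugate (?u b $ j))"
      using ab by (intro eq_matI) (auto simp: mat_block_def outer_def block_index_less)
    then have "mat_block n (outer (k * n) u) a b *\<^sub>v y = (y \<bullet>c ?u b) \<cdot>\<^sub>v ?u a"
      using y by (intro eq_vecI) (auto simp: scalar_prod_def sum_distrib_left sum_distrib_right mult_ac
        intro!: sum.cong)
    also have "\<dots> = X a *\<^sub>v ((y \<bullet>c (X b *\<^sub>v v)) \<cdot>\<^sub>v v)"
      using Xc[of a] v by (simp add: X(2) mult_mat_vec[of _ n n])
    also have "y \<bullet>c (X b *\<^sub>v v) = (mat_adjoint (X b) *\<^sub>v y) \<bullet>c v"
      using mult_mat_vec_cscalar_prod[OF mat_adjoint_carrier[OF Xc[of b]] y v] by simp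
    also have "X a *\<^sub>v ((mat_adjoint (X b) *\<^sub>v y) \<bullet>c v \<cdot>\<^sub>v v)
        = X a *\<^sub>v (outer n v *\<^sub>v (mat_adjoint (X b) *\<^sub>v y))"
      using v y mat_adjoint_carrier[OF Xc[of b]] by (simp add: outer_mult_vec)
    also have "\<dots> = X a * outer n v * mat_adjoint (X b) *\<^sub>v y"
      using y Xc[of a] mat_adjoint_carrier[OF Xc[of b]]
      by (simp add: assoc_mult_mat_vec[of _ n n _ n])
    finally show "mat_block n (outer (k * n) u) a b *\<^sub>v y = X a * outer n v * mat_adjoint (X b) *\<^sub>v y" .
  qed (use Xc[of a] Xc[of b] in auto)
  have "block_map k n n f (outer (k * n) u) = Y * ?P * mat_adjoint Y"
  proof (rule eq_matI)
    fix I J assume "I < dim_row (Y * ?P * mat_adjoint Y)" "J < dim_col (Y * ?P * mat_adjoint Y)"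
    then have IJ: "I < k * n" "J < k * n" using Yc by auto
    then have n: "n > 0" by (cases n) auto
    have dm: "I div n < k" "J div n < k" "I mod n < n" "J mod n < n"
      using IJ n by (auto simp: less_mult_imp_div_less)
    have "block_map k n n f (outer (k * n) u) $$ (I, J)
        = (X (I div n) * ?P * mat_adjoint (X (J div n))) $$ (I mod n, J mod n)"
      using IJ dm by (simp add: block_map_def block equiv X(1))
    \<comment> \<open>Row \<open>I\<close> of \<open>Y\<close> is row \<open>I mod n\<close> of
      \<open>X (I div n)\<close>, so both entries are the same double sum.\<close>
    also have "\<dots> = (Y * ?P * mat_adjoint Y) $$ (I, J)"
      using IJ dm Xc[of "I div n"] Xc[of "J div n"] P Yc
      by (simp add: scalar_prod_def) (simp add: Y_def)
    finally show "block_map k n n f (outer (k * n) u) $$ (I, J) = (Y * ?P * mat_adjoint Y) $$ (I, J)" .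
  qed (use Yc in \<open>auto simp: block_map_def\<close>)
  then show ?thesis using Yc by blast
qed

text \<open>Positivity of \<open>f\<close> enters through the single matrix
  \<open>outer n v\<close>. Congruence then handles every rank-one input, and linearity of the block
  map carries the result through \<open>psd_mat_induct\<close>.\<close>

lemma positive_imp_completely_positive:
  fixes f :: "'a::{conjugatable_ordered_field, ordered_comm_ring, field_gcd} mat \<Rightarrow> 'a mat"
  assumes f: "star_linear n n f" and L: "is_matricization n n f L" and C: "C \<in> carrier_mat n n"
    and LC: "L \<in> tensor_space n (map_mat conjugate ` bicommutant n C) (bicommutant n C)"
    and pos: "positive_map n n f"
  shows "completely_positive n n f"
proof -
  note fl = star_linearD[OF f]
  obtain v where v: "v \<in> carrier_vec n" and cyclic: "\<And>w. w \<in> carrier_vec n \<Longrightarrow> \<exists>X\<in>commutant n {C}. X *\<^sub>v v = w"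
    using commutant_cyclic_vector[OF C] by blast
  have P: "psd_mat n (f (outer n v))" using pos psd_mat_outer[OF v] by (simp add: positive_map_def)
  have "psd_mat (k * n) (block_map k n n f V)" if "psd_mat (k * n) V" for k V
    using that
  proof (induction V rule: psd_mat_induct)
    case zero
    have "f (0\<^sub>m n n) = f (0 \<cdot>\<^sub>m 0\<^sub>m n n)" by simp
    also have "\<dots> = 0\<^sub>m n n" using fl(1)[of "0\<^sub>m n n"] by (subst fl(3)) auto
    finally have f0: "f (0\<^sub>m n n) = 0\<^sub>m n n" .
    have "block_map k n n f (0\<^sub>m (k * n) (k * n)) = 0\<^sub>m (k * n) (k * n)"
    proof (rule eq_matI)
      fix i j assume "i < dim_row (0\<^sub>m (k * n) (k * n))" "j < dim_col (0\<^sub>m (k * n) (k * n))"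
      then have ij: "i < k * n" "j < k * n" by auto
      then have n: "n > 0" by (cases n) auto
      have dm: "i div n < k" "j div n < k" "i mod n < n" "j mod n < n"
        using ij n by (auto simp: less_mult_imp_div_less)
      have "mat_block n (0\<^sub>m (k * n) (k * n)) (i div n) (j div n) = (0\<^sub>m n n :: 'a mat)"
        using dm by (intro eq_matI) (auto simp: mat_block_def block_index_less)
      then show "block_map k n n f (0\<^sub>m (k * n) (k * n)) $$ (i, j) = 0\<^sub>m (k * n) (k * n) $$ (i, j)"
        using ij dm by (simp add: block_map_def f0)
    qed (auto simp: block_map_def)
    then show ?case by (simp add: psd_mat_zero)
  next
    case (add B c u)
    have Bc: "B \<in> carrier_mat (k * n) (k * n)" by (rule psd_matD(1)[OF add.hyps(1)])
    have "block_map k n n f (B + c \<cdot>\<^sub>m outer (k * n) u)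
        = block_map k n n f B + c \<cdot>\<^sub>m block_map k n n f (outer (k * n) u)"
    proof (rule eq_matI)
      fix i j assume "i < dim_row (block_map k n n f B + c \<cdot>\<^sub>m block_map k n n f (outer (k * n) u))"
        "j < dim_col (block_map k n n f B + c \<cdot>\<^sub>m block_map k n n f (outer (k * n) u))"
      then have ij: "i < k * n" "j < k * n" by (auto simp: block_map_def)
      then have n: "n > 0" by (cases n) auto
      have dm: "i div n < k" "j div n < k" "i mod n < n" "j mod n < n"
        using ij n by (auto simp: less_mult_imp_div_less)
      let ?V = "mat_block n B (i div n) (j div n)" and ?W = "mat_block n (outer (k * n) u) (i div n) (j div n)"
      have "f (?V + c \<cdot>\<^sub>m ?W) = f ?V + c \<cdot>\<^sub>m f ?W" by (simp add: fl)
      moreover have "f ?W \<in> carrier_mat n n" by (simp add: fl)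
      ultimately show "block_map k n n f (B + c \<cdot>\<^sub>m outer (k * n) u) $$ (i, j)
          = (block_map k n n f B + c \<cdot>\<^sub>m block_map k n n f (outer (k * n) u)) $$ (i, j)"
        using ij dm by (simp add: block_map_def mat_block_add_smult[OF Bc outer_carrier])
    qed (auto simp: block_map_def)
    moreover have "psd_mat (k * n) (block_map k n n f (outer (k * n) u))"
    proof -
      have "commutant n {C} \<subseteq> carrier_mat n n" by (auto simp: commutant_def)
      from block_map_outer[OF fl(1) this v cyclic tensor_space_equivariant[OF L fl(1) LC], of k u]
      show ?thesis using psd_mat_congruence[OF P] by force
    qed
    ultimately show ?case using add by (simp add: psd_mat_add psd_mat_smult)
  qed
  then show ?thesis by (simp add: completely_positive_def positive_map_def)
qed

text \<open>For \<open>k = 1\<close> the only block is \<open>V\<close> itself, so the block map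
  agrees with \<open>f\<close>.\<close>

lemma completely_positive_imp_positive:
  fixes f :: "'a::conjugatable_ordered_field mat \<Rightarrow> 'a mat"
  assumes f: "star_linear q n f" and cp: "completely_positive q n f"
  shows "positive_map q n f"
  unfolding positive_map_def
proof (intro allI impI)
  fix V :: "'a mat" assume V: "psd_mat q V"
  have Vc: "V \<in> carrier_mat q q" by (rule psd_matD(1)[OF V])
  have "mat_block q V 0 0 = V" using Vc by (intro eq_matI) (auto simp: mat_block_def)
  then have "block_map 1 q n f V = f V"
    using star_linearD(1)[OF f Vc] by (intro eq_matI) (auto simp: block_map_def)
  moreover have "psd_mat n (block_map 1 q n f V)"
    using cp V unfolding completely_positive_def positive_map_def
    by (metis le_refl mult_1)
  ultimately show "psd_mat n (f V)" by simp
qed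

text \<open>Counting the columns of \<open>L\<close> in two ways forces \<open>q = n\<close>, which
  reduces the claim to the square case.\<close>

lemma positive_iff_completely_positive:
  fixes f :: "'a::{conjugatable_ordered_field, ordered_comm_ring, field_gcd} mat \<Rightarrow> 'a mat"
  assumes f: "star_linear q n f" and L: "is_matricization q n f L" and C: "C \<in> carrier_mat n n"
    and LC: "L \<in> tensor_space n (map_mat conjugate ` bicommutant n C) (bicommutant n C)"
  shows "q = n \<and> (positive_map q n f \<longleftrightarrow> completely_positive q n f)"
proof -
  have S: "{kronecker A B |A B. A \<in> map_mat conjugate ` bicommutant n C \<and> B \<in> bicommutant n C}
      \<subseteq> carrier_mat (n\<^sup>2) (n\<^sup>2)"
    by (auto simp: power2_eq_square bicommutant_def commutant_def)
  \<comment> \<open>Commuting with the identity is automatic, so the span lemma serves here to give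
    the size of \<open>L\<close>.\<close>
  have "T * 1\<^sub>m (n\<^sup>2) = 1\<^sub>m (n\<^sup>2) * T" if "T \<in> carrier_mat (n\<^sup>2) (n\<^sup>2)" for T :: "'a mat"
    using that by simp
  with S have "L \<in> carrier_mat (n^2) (n^2)"
    using span_module_mat_commute[OF one_carrier_mat S _ LC[unfolded tensor_space_def]] by blast
  moreover have "L \<in> carrier_mat (n^2) (q^2)" using L by (simp add: is_matricization_def)
  ultimately have "q^2 = n^2" by auto
  then have "q = n" by (simp add: power2_eq_iff_nonneg)
  then show ?thesis
    using assms positive_imp_completely_positive completely_positive_imp_positive by blast
qed

theorem theorem1p2:
  shows
    "(\<forall>q n. \<forall>\<L> :: complex mat \<Rightarrow> complex mat. \<forall>L.
        star_linear q n \<L> \<and> is_matricization q n \<L> L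
        \<and> (\<exists>C \<in> carrier_mat n n.
             L \<in> tensor_space n (map_mat conjugate ` bicommutant n C) (bicommutant n C))
        \<longrightarrow> q = n \<and> (positive_map q n \<L> \<longleftrightarrow> completely_positive q n \<L>))
   \<and> (\<forall>q n. \<forall>\<L> :: real mat \<Rightarrow> real mat. \<forall>L.
        star_linear q n \<L> \<and> is_matricization q n \<L> L
        \<and> (\<exists>C \<in> carrier_mat n n.
             L \<in> tensor_space n (map_mat conjugate ` bicommutant n C) (bicommutant n C))
        \<longrightarrow> q = n \<and> (positive_map q n \<L> \<longleftrightarrow> completely_positive q n \<L>))"
  using positive_iff_completely_positive[where ?'a = complex]
    positive_iff_completely_positive[where ?'a = real]
  by blast

end
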